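(* Let $\mathcal{B} \subseteq \mathcal{A}$ be a unital inclusion of finite-dimensional $C^*$-algebras. Then the following statements are equivalent: (i) $\mathcal{B}$ is a generalised Cartan subalgebra of $\mathcal{A}$. (ii) $\mathcal{B}$ is regular in $\mathcal{A}$ and satisfies property Max$'$. (iii) $\mathcal{B}$ satisfies property Max$'$. (iv) $\mathcal{B}' \cap \mathcal{A} \subseteq \mathcal{B}$. (v) $\mathcal{B}' \cap \mathcal{A} = \mathcal{Z}(\mathcal{B})$. (vi) $\mathcal{B}$ is a multiplicity free subalgebra of $\mathcal{A}$. (vii) There is a unique conditional expectation from $\mathcal{A}$ onto $\mathcal{B}$.
   Context: $\mathbb{N}=\{1,2,\dots\}$. $\mathcal{B}'\cap\mathcal{A}$ is the relative commutant and $\mathcal{Z}(\mathcal{B})$ is the center of $\mathcal{B}$. A unital inclusion means $\mathcal{B}$ is a $C^*$-subalgebra containing $1_{\mathcal{A}}$. Conditional expectation: a linear, unital, completely positive map $E:\mathcal{A}\to\mathcal{B}$ with $E(b)=b$ for all $b\in\mathcal{B}$. It is faithful if $E(x^*x)>0$ (i.e. $E(x^*x)$ is a nonzero positive element) for every $x\neq 0$. Normalizer: $\mathcal{N}_{\mathcal{A}}(\mathcal{B})=\{n\in\mathcal{A}: n\mathcal{B}n^*\cup n^*\mathcal{B}n\subseteq\mathcal{B}\}$. $\mathcal{B}$ is regular in $\mathcal{A}$ if $C^*(\mathcal{N}_{\mathcal{A}}(\mathcal{B}))=\mathcal{A}$. Virtual commutant of $\mathcal{B}$ in $\mathcal{A}$: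 a linear map $\varphi:\mathcal{J}\to\mathcal{A}$, where $\mathcal{J}$ is a closed two-sided ideal of $\mathcal{B}$, with $\varphi(bx)=b\varphi(x)$ and $\varphi(xb)=\varphi(x)b$ for all $x\in\mathcal{J}$, $b\in\mathcal{B}$. $\mathcal{B}$ satisfies property Max$'$ (in $\mathcal{A}$) if the range of every virtual commutant of $\mathcal{B}$ in $\mathcal{A}$ is contained in $\mathcal{B}$. Generalised Cartan subalgebra (Exel): a $C^*$-subalgebra $\mathcal{B}\subseteq\mathcal{A}$ such that (a) $\mathcal{B}$ contains an approximate unit for $\mathcal{A}$; (b) $\mathcal{B}$ satisfies Max$'$; (c) $\mathcal{B}$ is regular in $\mathcal{A}$; (d) there exists a faithful conditional expectation $E:\mathcal{A}\to\mathcal{B}$. Multiplicity free: for $\vec{n}=(n_1,\dots,n_l)\in\mathbb{N}^l$ put $\mathbb{M}_{\vec{n}}(\mathbb{C})=\bigoplus_{i=1}^l\mathbb{M}_{n_i}(\mathbb{C})$. Given $\vec{d}\in\mathbb{N}^k$ and an $l\times k$ matrix $\Lambda$ with entries in $\mathbb{N}\cup\{0\}$, with no zero row or zero column, and $\Lambda\vec{d}=\vec{n}$, define the injective unital $*$-homomorphism $\Phi_\Lambda:\mathbb{M}_{\vec{d}}(\mathbb{C})\to\mathbb{M}_{\vec{n}}(\mathbb{C})$ whose $i$-th component at $x=(x_1,\dots,x_k)$ is the block diagonal matrix $\bigoplus_{j=1}^k (x_j\otimes\mathbb{I}_{\Lambda_{ij}})$, where $x_j\otimes\mathbb{I}_p$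 is the block diagonal matrix with $p$ diagonal blocks equal to $x_j$ (omitted if $p=0$). $\Lambda$ is called multiplicity free if $\sum_{i=1}^l\Lambda_{ij}\le 1$ for every $j=1,\dots,k$. Identify a finite-dimensional $C^*$-algebra $\mathcal{A}$ with some $\mathbb{M}_{\vec{n}}(\mathbb{C})$. A unital $C^*$-subalgebra $\mathcal{B}$ of $\mathbb{M}_{\vec{n}}(\mathbb{C})$ is multiplicity free if there is a unitary $u\in\mathbb{M}_{\vec{n}}(\mathbb{C})$ with $u\mathcal{B}u^*=\Phi_\Lambda(\mathbb{M}_{\vec{d}}(\mathbb{C}))$ for some $k\in\mathbb{N}$, $\vec{d}\in\mathbb{N}^k$ and some multiplicity free $l\times k$ matrix $\Lambda$. *)

theory Defs
  imports Complex_Main "Jordan_Normal_Form.Matrix" "Jordan_Normal_Form.Schur_Decomposition"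
begin

section \<open>Unital C*-algebras\<close>

text \<open>The class of (nonzero) unital C*-algebras over the complex numbers.  The library provides
  only real scalar multiplication; \<open>scaleR_scaleC\<close> ties it to the complex one.\<close>

class cstar_algebra = real_normed_algebra_1 + banach +
  fixes scaleC :: "complex \<Rightarrow> 'a \<Rightarrow> 'a"
    and star :: "'a \<Rightarrow> 'a"
  assumes scaleC_add_right: "scaleC c (x + y) = scaleC c x + scaleC c y"
    and scaleC_add_left: "scaleC (c + d) x = scaleC c x + scaleC d x"
    and scaleC_scaleC: "scaleC c (scaleC d x) = scaleC (c * d) x"
    and scaleC_one: "scaleC 1 x = x"
    and scaleR_scaleC: "scaleR r x = scaleC (complex_of_real r) x"
    and mult_scaleC_left: "scaleC c x * y = scaleC c (x * y)"
    and mult_scaleC_right: "x * scaleC c y = scaleC c (x * y)"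
    and norm_scaleC: "norm (scaleC c x) = cmod c * norm x"
    and star_add: "star (x + y) = star x + star y"
    and star_scaleC: "star (scaleC c x) = scaleC (cnj c) (star x)"
    and star_mult: "star (x * y) = star y * star x"
    and star_star: "star (star x) = x"
    and cstar_identity: "norm (star x * x) = (norm x)\<^sup>2"

interpretation complex_space: vector_space "scaleC :: complex \<Rightarrow> 'a \<Rightarrow> 'a::cstar_algebra"
  by unfold_locales (simp_all add: scaleC_add_right scaleC_add_left scaleC_scaleC scaleC_one)

definition finite_dimensional :: "'a::cstar_algebra itself \<Rightarrow> bool" where
  "finite_dimensional TYPE('a) \<longleftrightarrow>
     (\<exists>S :: 'a set. finite S \<and> complex_space.span S = UNIV)"

definition cstar_subalgebra :: "'a::cstar_algebra set \<Rightarrow> bool" where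
  "cstar_subalgebra B \<longleftrightarrow>
     complex_space.subspace B \<and> closed B \<and>
     (\<forall>x\<in>B. \<forall>y\<in>B. x * y \<in> B) \<and> (\<forall>x\<in>B. star x \<in> B)"

definition unital_cstar_subalgebra :: "'a::cstar_algebra set \<Rightarrow> bool" where
  "unital_cstar_subalgebra B \<longleftrightarrow> cstar_subalgebra B \<and> 1 \<in> B"

definition positive_in :: "'a::cstar_algebra set \<Rightarrow> 'a \<Rightarrow> bool" where
  "positive_in B x \<longleftrightarrow> (\<exists>y\<in>B. x = star y * y)"

definition relative_commutant :: "'a::cstar_algebra set \<Rightarrow> 'a set" where
  "relative_commutant B = {a. \<forall>b\<in>B. a * b = b * a}"

definition center :: "'a::cstar_algebra set \<Rightarrow> 'a set" where
  "center B = {z \<in> B. \<forall>b\<in>B. z * b = b * z}"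

section \<open>Conditional expectations\<close>

text \<open>Positive elements of the C*-algebra of \<open>m \<times> m\<close> matrices over \<open>B\<close>, i.e. those of the
  form \<open>Y*Y\<close>, where \<open>Y*\<close> is the transpose of \<open>Y\<close> with \<^const>\<open>star\<close> applied entrywise.\<close>

definition mat_positive_in :: "nat \<Rightarrow> 'a::cstar_algebra set \<Rightarrow> 'a mat \<Rightarrow> bool" where
  "mat_positive_in m B X \<longleftrightarrow>
     (\<exists>Y \<in> carrier_mat m m. elements_mat Y \<subseteq> B \<and> X = map_mat star (transpose_mat Y) * Y)"

definition completely_positive :: "'a::cstar_algebra set \<Rightarrow> ('a \<Rightarrow> 'a) \<Rightarrow> bool" where
  "completely_positive B E \<longleftrightarrow>
     (\<forall>m\<ge>1. \<forall>X. mat_positive_in m UNIV X \<longrightarrow> mat_positive_in m B (map_mat E X))"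

definition conditional_expectation :: "'a::cstar_algebra set \<Rightarrow> ('a \<Rightarrow> 'a) \<Rightarrow> bool" where
  "conditional_expectation B E \<longleftrightarrow>
     range E \<subseteq> B \<and> Vector_Spaces.linear scaleC scaleC E \<and> E 1 = 1 \<and>
     completely_positive B E \<and> (\<forall>b\<in>B. E b = b)"

definition faithful :: "'a::cstar_algebra set \<Rightarrow> ('a \<Rightarrow> 'a) \<Rightarrow> bool" where
  "faithful B E \<longleftrightarrow>
     (\<forall>x. x \<noteq> 0 \<longrightarrow> positive_in B (E (star x * x)) \<and> E (star x * x) \<noteq> 0)"

section \<open>Regularity, virtual commutants and generalised Cartan subalgebras\<close>

definition normalizer :: "'a::cstar_algebra set \<Rightarrow> 'a set" where
  "normalizer B = {n. (\<forall>b\<in>B. n * b * star n \<in> B) \<and> (\<forall>b\<in>B. star n * b * n \<in> B)}"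

definition regular :: "'a::cstar_algebra set \<Rightarrow> bool" where
  "regular B \<longleftrightarrow> cstar_subalgebra hull normalizer B = UNIV"

definition closed_ideal :: "'a::cstar_algebra set \<Rightarrow> 'a set \<Rightarrow> bool" where
  "closed_ideal J B \<longleftrightarrow>
     J \<subseteq> B \<and> complex_space.subspace J \<and> closed J \<and>
     (\<forall>b\<in>B. \<forall>x\<in>J. b * x \<in> J \<and> x * b \<in> J)"

text \<open>The values of \<open>\<phi>\<close> outside its domain \<open>J\<close> are irrelevant.\<close>

definition virtual_commutant :: "'a::cstar_algebra set \<Rightarrow> 'a set \<Rightarrow> ('a \<Rightarrow> 'a) \<Rightarrow> bool" where
  "virtual_commutant B J \<phi> \<longleftrightarrow>
     closed_ideal J B \<and>
     (\<forall>x\<in>J. \<forall>y\<in>J. \<phi> (x + y) = \<phi> x + \<phi> y) \<and>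
     (\<forall>c. \<forall>x\<in>J. \<phi> (scaleC c x) = scaleC c (\<phi> x)) \<and>
     (\<forall>b\<in>B. \<forall>x\<in>J. \<phi> (b * x) = b * \<phi> x \<and> \<phi> (x * b) = \<phi> x * b)"

definition Max' :: "'a::cstar_algebra set \<Rightarrow> bool" where
  "Max' B \<longleftrightarrow> (\<forall>J \<phi>. virtual_commutant B J \<phi> \<longrightarrow> \<phi> ` J \<subseteq> B)"

text \<open>An approximate unit, i.e. a net of positive contractions in \<open>B\<close> acting as a unit on the
  whole algebra in the limit; the net is represented by the filter it generates.\<close>

definition contains_approximate_unit :: "'a::cstar_algebra set \<Rightarrow> bool" where
  "contains_approximate_unit B \<longleftrightarrow>
     (\<exists>F :: 'a filter. F \<noteq> bot \<and>
        (\<forall>\<^sub>F e in F. e \<in> B \<and> positive_in UNIV e \<and> norm e \<le> 1) \<and>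
        (\<forall>a. ((\<lambda>e. e * a) \<longlongrightarrow> a) F \<and> ((\<lambda>e. a * e) \<longlongrightarrow> a) F))"

definition generalised_cartan :: "'a::cstar_algebra set \<Rightarrow> bool" where
  "generalised_cartan B \<longleftrightarrow>
     cstar_subalgebra B \<and> contains_approximate_unit B \<and> Max' B \<and> regular B \<and>
     (\<exists>E. conditional_expectation B E \<and> faithful B E)"

section \<open>Multiplicity free subalgebras\<close>

text \<open>Tuples of positive integers, and elements of direct sums of full matrix algebras, are
  represented by lists; all operations on the latter are componentwise.\<close>

definition dim_tuple :: "nat list \<Rightarrow> bool" where
  "dim_tuple ns \<longleftrightarrow> ns \<noteq> [] \<and> (\<forall>n \<in> set ns. 1 \<le> n)"

definition matrix_sum :: "nat list \<Rightarrow> complex mat list set" where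
  "matrix_sum ns =
     {xs. length xs = length ns \<and> (\<forall>i<length ns. xs ! i \<in> carrier_mat (ns ! i) (ns ! i))}"

definition star_isomorphism :: "nat list \<Rightarrow> ('a::cstar_algebra \<Rightarrow> complex mat list) \<Rightarrow> bool" where
  "star_isomorphism ns \<theta> \<longleftrightarrow>
     bij_betw \<theta> UNIV (matrix_sum ns) \<and>
     (\<forall>x y. \<theta> (x + y) = map2 (+) (\<theta> x) (\<theta> y)) \<and>
     (\<forall>c x. \<theta> (scaleC c x) = map (\<lambda>M. c \<cdot>\<^sub>m M) (\<theta> x)) \<and>
     (\<forall>x y. \<theta> (x * y) = map2 (*) (\<theta> x) (\<theta> y)) \<and>
     (\<forall>x. \<theta> (star x) = map mat_adjoint (\<theta> x))"

definition unitary_in :: "nat list \<Rightarrow> complex mat list \<Rightarrow> bool" where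
  "unitary_in ns us \<longleftrightarrow>
     us \<in> matrix_sum ns \<and>
     (\<forall>i<length ns. mat_adjoint (us ! i) * us ! i = 1\<^sub>m (ns ! i) \<and>
                    us ! i * mat_adjoint (us ! i) = 1\<^sub>m (ns ! i))"

definition inclusion_matrix :: "nat list \<Rightarrow> nat list \<Rightarrow> nat mat \<Rightarrow> bool" where
  "inclusion_matrix ns ds \<Lambda> \<longleftrightarrow>
     \<Lambda> \<in> carrier_mat (length ns) (length ds) \<and>
     (\<forall>i<length ns. row \<Lambda> i \<noteq> 0\<^sub>v (length ds)) \<and>
     (\<forall>j<length ds. col \<Lambda> j \<noteq> 0\<^sub>v (length ns)) \<and>
     \<Lambda> *\<^sub>v vec_of_list ds = vec_of_list ns"

definition Phi :: "nat mat \<Rightarrow> complex mat list \<Rightarrow> complex mat list" where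
  "Phi \<Lambda> xs =
     map (\<lambda>i. diag_block_mat
            (concat (map (\<lambda>j. replicate (\<Lambda> $$ (i, j)) (xs ! j)) [0..<dim_col \<Lambda>])))
       [0..<dim_row \<Lambda>]"

definition multiplicity_free_matrix :: "nat mat \<Rightarrow> bool" where
  "multiplicity_free_matrix \<Lambda> \<longleftrightarrow>
     (\<forall>j<dim_col \<Lambda>. (\<Sum>i<dim_row \<Lambda>. \<Lambda> $$ (i, j)) \<le> 1)"

text \<open>The isomorphism \<open>\<theta>\<close> is the identification of the ambient finite-dimensional algebra with a
  direct sum of matrix algebras.\<close>

definition multiplicity_free :: "'a::cstar_algebra set \<Rightarrow> bool" where
  "multiplicity_free B \<longleftrightarrow>
     unital_cstar_subalgebra B \<and>
     (\<exists>ns \<theta>. dim_tuple ns \<and> star_isomorphism ns \<theta> \<and>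
        (\<exists>us ds \<Lambda>. unitary_in ns us \<and> dim_tuple ds \<and>
           inclusion_matrix ns ds \<Lambda> \<and> multiplicity_free_matrix \<Lambda> \<and>
           (\<lambda>b. map2 (\<lambda>u x. u * x * mat_adjoint u) us (\<theta> b)) ` B = Phi \<Lambda> ` matrix_sum ds))"

end

theory Submission
  imports Defs "HOL-Computational_Algebra.Fundamental_Theorem_Algebra"
begin

text \<open>Write \<open>1\<close> as a sum of orthogonal minimal projections \<open>f\<close> of \<open>B\<close> and complete them to matrix
  units of \<open>B\<close>.  An element of \<open>f A f\<close> can be copied along the class of \<open>f\<close> to an element of
  \<open>B' \<inter> A\<close>, so \<open>B' \<inter> A \<subseteq> B\<close> holds iff every \<open>f\<close> is still minimal in \<open>A\<close>.  In that case each
  \<open>f A g\<close> is at most one-dimensional; it consists of normalizers, is contained in \<open>B\<close> if \<open>f\<close> and \<open>g\<close>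
  are equivalent in \<open>B\<close>, and is killed by every conditional expectation otherwise.  Hence \<open>B\<close> is
  regular, the expectation is unique and faithful, and in matrix units of \<open>A\<close> over the same
  projections \<open>B\<close> becomes the algebra of all block diagonal matrices.  If some \<open>f\<close> is not minimal
  in \<open>A\<close>, compressing by different minimal projections of \<open>A\<close> below \<open>f\<close> gives different
  expectations.  The norm enters only through \<open>x\<^sup>* x = 0 \<Longrightarrow> x = 0\<close>.\<close>

section \<open>Projections\<close>

text \<open>The obstacle is positivity, which is available only through factorisations
  \<open>star y * y\<close>, and over matrices for complete positivity. To show that a map is an
  expectation, a factor with entries in \<open>B\<close> must be exhibited. Applying a pure state in
  each class reduces this to factorising a positive semidefinite complex matrix, whose square factor
  is read back in matrix units. Conversely, of a given expectation only such factorisations are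
  known; the 2 by 2 case yields compatibility with \<open>star\<close> and with multiplication by
  projections of \<open>B\<close>, which suffices to compare corners. Finite dimension enters
  through annihilating polynomials, whose roots give spectral projections, and through the dimension
  of corners, which decreases when a projection is split. Condition (iv) is the hub to which every
  other condition is tied. For (iii), an ideal of \<open>B\<close> has a unit \<open>u\<close> that
  is central in \<open>B\<close>, and a virtual commutant is multiplication by its value at
  \<open>u\<close>.\<close>

declare scaleC_scaleC [simp] scaleC_one [simp] star_add [simp] star_scaleC [simp] star_star [simp]
  mult_scaleC_left [simp] mult_scaleC_right [simp]

lemma star_zero [simp]: "star (0::'a::cstar_algebra) = 0"
  by (metis add_cancel_right_right star_add)

lemma star_minus [simp]: "star (- x) = - star (x::'a::cstar_algebra)"
  by (metis add.right_inverse add_eq_0_iff star_add star_zero)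

lemma star_diff [simp]: "star (x - y) = star x - star (y::'a::cstar_algebra)"
  by (metis diff_conv_add_uminus star_add star_minus)

lemma star_one [simp]: "star (1::'a::cstar_algebra) = 1"
  by (metis mult_1 mult_1_right star_mult star_star)

lemma star_sum [simp]: "star (sum f I) = (\<Sum>i\<in>I. star (f i :: 'a::cstar_algebra))"
  by (induction I rule: infinite_finite_induct) auto

lemma star_mult_self_eq_0_iff [simp]: "star x * x = 0 \<longleftrightarrow> (x::'a::cstar_algebra) = 0"
  using cstar_identity[of x] by auto

lemma star_eq_0_iff [simp]: "star x = 0 \<longleftrightarrow> (x::'a::cstar_algebra) = 0"
  by (metis star_star star_zero)

definition projection :: "'a::cstar_algebra \<Rightarrow> bool" where
  "projection p \<longleftrightarrow> p * p = p \<and> star p = p"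

definition minimal_projection :: "'a::cstar_algebra set \<Rightarrow> 'a \<Rightarrow> bool" where
  "minimal_projection S p \<longleftrightarrow>
     p \<in> S \<and> projection p \<and> p \<noteq> 0 \<and> (\<forall>x\<in>S. \<exists>c. p * x * p = scaleC c p)"

definition corner :: "'a::cstar_algebra set \<Rightarrow> 'a \<Rightarrow> 'a set" where
  "corner S p = (\<lambda>x. p * x * p) ` S"

lemma unital_UNIV: "unital_cstar_subalgebra (UNIV :: 'a::cstar_algebra set)"
  by (simp add: unital_cstar_subalgebra_def cstar_subalgebra_def)

context
  fixes S :: "'a::cstar_algebra set"
  assumes S: "unital_cstar_subalgebra S"
begin

lemma subalg_subspace: "complex_space.subspace S"
  using S by (simp add: unital_cstar_subalgebra_def cstar_subalgebra_def)

lemma subalg_one: "1 \<in> S"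
  using S by (simp add: unital_cstar_subalgebra_def)

lemma subalg_mult: "x \<in> S \<Longrightarrow> y \<in> S \<Longrightarrow> x * y \<in> S"
  using S by (simp add: unital_cstar_subalgebra_def cstar_subalgebra_def)

lemma subalg_star: "x \<in> S \<Longrightarrow> star x \<in> S"
  using S by (simp add: unital_cstar_subalgebra_def cstar_subalgebra_def)

lemmas subalg_add = complex_space.subspace_add[OF subalg_subspace]
lemmas subalg_diff = complex_space.subspace_diff[OF subalg_subspace]
lemmas subalg_scale = complex_space.subspace_scale[OF subalg_subspace]
lemmas subalg_sum = complex_space.subspace_sum[OF subalg_subspace]
lemmas subalg_zero = complex_space.subspace_0[OF subalg_subspace]

lemmas subalg_closed = subalg_one subalg_mult subalg_star subalg_add subalg_diff subalg_scale
  subalg_sum subalg_zero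

end

section \<open>Polynomials in an algebra element\<close>

definition peval :: "complex poly \<Rightarrow> 'a::cstar_algebra \<Rightarrow> 'a" where
  "peval P h = fold_coeffs (\<lambda>c y. scaleC c 1 + h * y) P 0"

lemma peval_0 [simp]: "peval 0 h = 0"
  by (simp add: peval_def)

lemma peval_pCons [simp]: "peval (pCons a P) h = scaleC a 1 + h * peval P h"
  by (cases "P = 0 \<and> a = 0") (auto simp: peval_def)

lemma peval_add: "peval (P + Q) h = peval P h + peval Q h"
  by (induction P Q rule: poly_induct2)
    (simp_all add: scaleC_add_left algebra_simps)

lemma peval_smult: "peval (Polynomial.smult c P) h = scaleC c (peval P h)"
  by (induction P) (simp_all add: scaleC_add_right)

lemma peval_diff: "peval (P - Q) h = peval P h - peval Q h"
  by (metis add_diff_cancel diff_add_cancel peval_add)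

lemma peval_sum: "peval (sum F I) h = (\<Sum>i\<in>I. peval (F i) h)"
  by (induction I rule: infinite_finite_induct) (simp_all add: peval_add)

lemma peval_monom: "peval (monom c n) h = scaleC c (h ^ n)"
  by (induction n) (simp_all add: monom_0 monom_Suc)

lemma peval_linear_factor: "peval ([:-a, 1:] * Q) h = h * peval Q h - scaleC a (peval Q h)"
  by (simp add: peval_add peval_diff peval_smult)

lemma peval_commute:
  assumes "h * y = y * h" shows "peval P h * y = y * peval P h"
proof (induction P)
  case (pCons a P)
  then show ?case by (simp add: algebra_simps) (metis assms mult.assoc)
qed simp

lemma star_peval: "star (peval P h) = peval (map_poly cnj P) (star h)"
proof (induction P)
  case (pCons a P)
  then show ?case
    by (simp add: map_poly_pCons star_mult) (metis peval_commute)
qed simp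

lemma peval_eigenvector:
  assumes "h * y = scaleC l y"
  shows "peval P h * y = scaleC (poly P l) y"
proof (induction P)
  case (pCons a P)
  have "h * peval P h * y = scaleC (poly P l) (h * y)"
    using pCons.IH by (simp add: mult.assoc)
  then show ?case by (simp add: assms scaleC_add_left distrib_right mult.commute)
qed simp

lemma peval_in_subalg:
  assumes "unital_cstar_subalgebra S" "h \<in> S" shows "peval P h \<in> S"
  by (induction P) (auto intro!: subalg_closed[OF assms(1)] assms(2))

text \<open>One more power of \<open>h\<close> than a finite spanning set has elements must be
  linearly dependent, and a dependence relation is a polynomial.\<close>

lemma exists_annihilating_poly:
  fixes h :: "'a::cstar_algebra"
  assumes "finite_dimensional TYPE('a)"
  shows "\<exists>P. P \<noteq> 0 \<and> peval P h = 0"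
proof -
  obtain T :: "'a set" where T: "finite T" "complex_space.span T = UNIV"
    using assms by (auto simp: finite_dimensional_def)
  show ?thesis
  \<comment> \<open>Dependence is a property of sets and does not see a coincidence among the
    powers; that case gives a difference of two monomials.\<close>
  proof (cases "inj_on (\<lambda>i. h ^ i) {..card T}")
    case False
    then obtain i j where "i \<noteq> j" "h ^ i = h ^ j" by (auto simp: inj_on_def)
    then have "coeff (monom 1 i - monom 1 j :: complex poly) i \<noteq> 0"
      "peval (monom 1 i - monom 1 j) h = 0"
      by (auto simp: peval_diff peval_monom)
    then show ?thesis by (metis coeff_0)
  next
    case True
    define V where "V = (\<lambda>i. h ^ i) ` {..card T}"
    have "card V = Suc (card T)" "finite V" by (simp_all add: V_def card_image True)
    then have "complex_space.dependent V"
      using complex_space.independent_span_bound[OF T(1), of V] T(2) by auto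
    then obtain u where u: "\<exists>w\<in>V. u w \<noteq> 0" "(\<Sum>w\<in>V. scaleC (u w) w) = 0"
      using complex_space.dependent_finite[OF \<open>finite V\<close>] by auto
    define P where "P = (\<Sum>i\<le>card T. monom (u (h ^ i)) i)"
    have "peval P h = (\<Sum>w\<in>V. scaleC (u w) w)"
      by (simp add: P_def peval_sum peval_monom V_def sum.reindex True)
    moreover obtain i where "i \<le> card T" "u (h ^ i) \<noteq> 0"
      using u(1) by (auto simp: V_def)
    then have "coeff P i \<noteq> 0"
      by (simp add: P_def coeff_sum sum.delta)
    ultimately show ?thesis using u(2) by (intro exI[of _ P]) auto
  qed
qed

text \<open>The cofactor of a root of the minimal polynomial of \<open>h\<close> is, up to a scalar, a spectral
  projection of \<open>h\<close>.\<close>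

lemma spectral_projection_exists:
  fixes S :: "'a::cstar_algebra set"
  assumes fd: "finite_dimensional TYPE('a)" and S: "unital_cstar_subalgebra S"
    and p: "p \<in> S" "projection p" "p \<noteq> 0"
    and h: "h \<in> S" "star h = h" "h * p = h" "p * h = h"
  shows "\<exists>q l. q \<in> S \<and> projection q \<and> q \<noteq> 0 \<and> q * p = q \<and> h * q = scaleC l q"
proof -
  have pp: "p * p = p" "star p = p" using p by (auto simp: projection_def)
  \<comment> \<open>Descent on the degree: a cofactor that still annihilates \<open>p\<close> is a
    smaller polynomial of the same kind; otherwise its value times \<open>p\<close> is a nonzero
    eigenvector. A nonzero constant cannot annihilate \<open>p\<close>.\<close>
  have *: "\<exists>l g. h * (peval g h * p) = scaleC l (peval g h * p) \<and> peval g h * p \<noteq> 0"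
    if "P \<noteq> 0" "peval P h * p = 0" for P
    using that
  proof (induction "degree P" arbitrary: P rule: less_induct)
    case less
    show ?case
    proof (cases "degree P = 0")
      case True
      then obtain c where "P = [:c:]" by (metis degree_eq_zeroE)
      then show ?thesis using less.prems p(3) by auto
    next
      case False
      then obtain l where "poly P l = 0"
        using fundamental_theorem_of_algebra_alt by (metis degree_pCons_0 less_numeral_extra(3))
      then obtain g where g: "P = [:-l, 1:] * g" by (metis dvd_def poly_eq_0_iff_dvd)
      then have "g \<noteq> 0" using less.prems by auto
      show ?thesis
      proof (cases "peval g h * p = 0")
        case True
        have "degree g < degree P" unfolding g using \<open>g \<noteq> 0\<close> by (subst degree_mult_eq) auto
        then show ?thesis using less.hyps True \<open>g \<noteq> 0\<close> by blast
      next
        case False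
        have "h * (peval g h * p) = scaleC l (peval g h * p)"
          using less.prems(2) unfolding g peval_linear_factor by (simp add: algebra_simps)
        then show ?thesis using False by blast
      qed
    qed
  qed
  obtain P where "P \<noteq> 0" "peval P h = 0" using exists_annihilating_poly[OF fd] by blast
  then have "peval P h * p = 0" by simp
  from *[OF \<open>P \<noteq> 0\<close> this]
  obtain l g where g: "h * (peval g h * p) = scaleC l (peval g h * p)" "peval g h * p \<noteq> 0"
    by blast
  define y where "y = peval g h * p"
  have com: "peval Q h * p = p * peval Q h" for Q
    by (intro peval_commute) (simp add: h)
  have ev: "peval Q h * y = scaleC (poly Q l) y" for Q
    using g by (intro peval_eigenvector) (simp add: y_def)
  have py: "p * y = y" unfolding y_def com by (simp flip: mult.assoc add: pp)
  have yp: "y * p = y" by (simp add: y_def mult.assoc pp)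
  have yS: "y \<in> S" unfolding y_def by (intro subalg_closed[OF S] peval_in_subalg[OF S] h p)
  have sy: "star y = peval (map_poly cnj g) h * p"
    by (simp add: y_def star_mult star_peval h pp com)
  define m where "m = poly (map_poly cnj g) l"
  have z: "star y * y = scaleC m y" using ev[of "map_poly cnj g"] by (simp add: sy mult.assoc py m_def)
  have "y \<noteq> 0" using g by (simp add: y_def)
  then have "m \<noteq> 0" using z by auto
  \<comment> \<open>\<open>w\<close> is self-adjoint with \<open>w * w = scaleC n w\<close>. The
    C*-identity excludes \<open>n = 0\<close>, and self-adjointness makes \<open>n\<close> real, so
    \<open>w / n\<close> is a projection.\<close>
  define w where "w = star y * y"
  define n where "n = m * poly g l"
  have sw: "star w = w" by (simp add: w_def star_mult)
  have "y * y = scaleC (poly g l) y" using ev[of g] py by (simp add: y_def mult.assoc)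
  then have ww: "w * w = scaleC n w" by (simp add: w_def z n_def mult_ac)
  have "w \<noteq> 0" using \<open>y \<noteq> 0\<close> by (simp add: w_def)
  then have "star w * w \<noteq> 0" by simp
  then have "n \<noteq> 0" using ww sw by auto
  have "star (w * w) = w * w" by (simp add: star_mult sw)
  then have "scaleC (cnj n) w = scaleC n w" unfolding ww by (simp add: sw)
  then have "cnj n = n" using \<open>w \<noteq> 0\<close> by simp
  define q where "q = scaleC (1 / n) w"
  have "projection q" using \<open>n \<noteq> 0\<close> \<open>cnj n = n\<close>
    by (simp add: projection_def q_def ww sw)
  moreover have "q \<in> S" unfolding q_def w_def by (intro subalg_closed[OF S] yS)
  moreover have "q \<noteq> 0" using \<open>n \<noteq> 0\<close> \<open>w \<noteq> 0\<close> by (simp add: q_def)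
  moreover have "q * p = q" by (simp add: q_def w_def mult.assoc yp)
  moreover have "h * y = scaleC l y" using g by (simp add: y_def)
  then have "h * q = scaleC l q" unfolding q_def w_def z by (simp add: mult.commute)
  ultimately show ?thesis by blast
qed

section \<open>Splitting projections into minimal ones\<close>

lemma subprojection_commute: "projection p \<Longrightarrow> projection q \<Longrightarrow> q * p = q \<Longrightarrow> p * q = q"
  by (metis projection_def star_mult)

lemma projection_diff:
  "projection p \<Longrightarrow> projection q \<Longrightarrow> q * p = q \<Longrightarrow> projection (p - q)"
  using subprojection_commute[of p q] by (simp add: projection_def algebra_simps)

text \<open>Nonminimality provides a corner element that is not a multiple of \<open>p\<close>, and
  then a self-adjoint one. A spectral projection of it differs from \<open>p\<close>, since
  \<open>h * p = scaleC l p\<close> would make \<open>h\<close> a multiple of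
  \<open>p\<close>.\<close>

lemma nonminimal_projection_splits:
  fixes S :: "'a::cstar_algebra set"
  assumes fd: "finite_dimensional TYPE('a)" and S: "unital_cstar_subalgebra S"
    and p: "p \<in> S" "projection p" "p \<noteq> 0" "\<not> minimal_projection S p"
  shows "\<exists>q\<in>S. projection q \<and> q \<noteq> 0 \<and> q \<noteq> p \<and> q * p = q"
proof -
  have pp: "p * p = p" "star p = p" using p by (auto simp: projection_def)
  obtain x where x: "x \<in> S" "\<And>c. p * x * p \<noteq> scaleC c p"
    using p by (auto simp: minimal_projection_def)
  define y where "y = p * x * p"
  have y: "y \<in> S" "p * y = y" "y * p = y" unfolding y_def
    by (auto intro!: subalg_closed[OF S] p x simp: mult.assoc pp) (simp flip: mult.assoc add: pp)
  have ys: "p * star y = star y" "star y * p = star y"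
    using y(2,3) by (metis pp(2) star_mult)+
  \<comment> \<open>Real and imaginary part of \<open>y\<close>; they cannot both be multiples of
    \<open>p\<close>.\<close>
  define a where "a = scaleC (1/2) (y + star y)"
  define b where "b = scaleC (- \<i> / 2) (y - star y)"
  have ab: "y = a + scaleC \<i> b"
    by (simp add: a_def b_def scaleC_add_right complex_space.scale_right_diff_distrib
        flip: scaleC_add_left)
  have "\<exists>h\<in>S. star h = h \<and> h * p = h \<and> p * h = h \<and> (\<forall>c. h \<noteq> scaleC c p)"
  proof (cases "\<exists>c. a = scaleC c p")
    case False
    then show ?thesis
      by (intro bexI[of _ a]) (auto simp: a_def y ys algebra_simps intro!: subalg_closed[OF S] y)
  next
    case True
    then obtain c where c: "a = scaleC c p" by blast
    have "b \<noteq> scaleC d p" for d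
      using x(2)[of "c + \<i> * d"] ab by (auto simp: c y_def scaleC_add_left)
    moreover have "star b = b"
      by (simp add: b_def complex_space.scale_right_diff_distrib)
    ultimately show ?thesis
      by (intro bexI[of _ b]) (auto simp: b_def y ys algebra_simps intro!: subalg_closed[OF S] y)
  qed
  then obtain h where h: "h \<in> S" "star h = h" "h * p = h" "p * h = h" "\<And>c. h \<noteq> scaleC c p"
    by blast
  obtain q l where "q \<in> S" "projection q" "q \<noteq> 0" "q * p = q" "h * q = scaleC l q"
    using spectral_projection_exists[OF fd S p(1-3) h(1-4)] by blast
  moreover from this have "q \<noteq> p" using h(3,5) by metis
  ultimately show ?thesis by blast
qed

text \<open>Provides the strict descent for the decomposition below. Right multiplication by
  \<open>q\<close> fixes the corner of \<open>q\<close> but moves \<open>p\<close>, which lies in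
  its own corner.\<close>

lemma corner_psubset:
  assumes S: "unital_cstar_subalgebra S" and "p \<in> S" "q \<in> S"
    and p: "projection p" and q: "projection q" "q * p = q" "q \<noteq> p"
  shows "corner S q \<subset> corner S p"
proof -
  have pq: "p * q = q" "p * p = p" "q * q = q"
    using subprojection_commute[OF p q(1,2)] p q by (auto simp: projection_def)
  have "q * x * q = p * (q * x * q) * p" for x
    by (metis mult.assoc pq(1) q(2))
  then have "corner S q \<subseteq> corner S p"
    unfolding corner_def using assms(3) by (auto intro!: imageI subalg_closed[OF S])
  moreover have "p \<in> corner S p"
    unfolding corner_def using subalg_one[OF S] by (intro image_eqI[of _ _ 1]) (simp_all add: pq)
  moreover have "p \<notin> corner S q"
  proof
    assume "p \<in> corner S q"
    then obtain x where "p = q * x * q" by (auto simp: corner_def)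
    then have "p * q = p" by (simp add: mult.assoc pq)
    then show False using pq q by simp
  qed
  ultimately show ?thesis by blast
qed

lemma corner_subspace:
  assumes "unital_cstar_subalgebra S" shows "complex_space.subspace (corner S p)"
  unfolding complex_space.subspace_def corner_def
proof (intro conjI ballI allI)
  show "0 \<in> (\<lambda>x. p * x * p) ` S" by (intro image_eqI[of _ _ 0] subalg_closed[OF assms]) simp
next
  fix x y assume "x \<in> (\<lambda>x. p * x * p) ` S" "y \<in> (\<lambda>x. p * x * p) ` S"
  then obtain a b where "x = p * a * p" "y = p * b * p" "a \<in> S" "b \<in> S" by blast
  then show "x + y \<in> (\<lambda>x. p * x * p) ` S"
    by (intro image_eqI[of _ _ "a + b"] subalg_closed[OF assms]) (auto simp: algebra_simps)
next
  fix c x assume "x \<in> (\<lambda>x. p * x * p) ` S"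
  then obtain a where "x = p * a * p" "a \<in> S" by blast
  then show "scaleC c x \<in> (\<lambda>x. p * x * p) ` S"
    by (intro image_eqI[of _ _ "scaleC c a"] subalg_closed[OF assms]) auto
qed

lemma dim_strict_mono:
  fixes U V :: "'a::cstar_algebra set"
  assumes "finite_dimensional TYPE('a)" "complex_space.subspace U" "complex_space.subspace V" "U \<subset> V"
  shows "complex_space.dim U < complex_space.dim V"
proof -
  obtain T :: "'a set" where T: "finite T" "complex_space.span T = UNIV"
    using assms by (auto simp: finite_dimensional_def)
  obtain Bs where Bs: "Bs \<subseteq> T" "complex_space.independent Bs" "T \<subseteq> complex_space.span Bs"
    using complex_space.maximal_independent_subset[of T] by blast
  interpret fin: finite_dimensional_vector_space "scaleC :: complex \<Rightarrow> 'a \<Rightarrow> 'a" Bs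
    using Bs T finite_subset complex_space.span_mono[OF Bs(3)]
    by unfold_locales (auto simp: complex_space.span_span)
  show ?thesis using assms fin.dim_psubset
    by (metis complex_space.span_eq_iff)
qed

definition orthogonal_decomposition :: "'a::cstar_algebra set \<Rightarrow> 'a set \<Rightarrow> 'a \<Rightarrow> bool" where
  "orthogonal_decomposition S F p \<longleftrightarrow>
     finite F \<and> (\<forall>f\<in>F. minimal_projection S f) \<and> (\<forall>f\<in>F. \<forall>g\<in>F. f \<noteq> g \<longrightarrow> f * g = 0) \<and> \<Sum>F = p"

lemma orthogonal_decomposition_below:
  assumes "orthogonal_decomposition S F p" "f \<in> F"
  shows "f * p = f" "p * f = f"
proof -
  have F: "finite F" "\<And>g. g \<in> F \<Longrightarrow> g \<noteq> f \<Longrightarrow> f * g = 0" "\<And>g. g \<in> F \<Longrightarrow> g \<noteq> f \<Longrightarrow> g * f = 0"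
    "f * f = f" "p = \<Sum>F"
    using assms by (auto simp: orthogonal_decomposition_def minimal_projection_def projection_def)
  have "f * p = (\<Sum>g\<in>F. if g = f then f else 0)"
    unfolding F(5) sum_distrib_left using F by (intro sum.cong) auto
  then show "f * p = f" using F(1) assms by simp
  have "p * f = (\<Sum>g\<in>F. if g = f then f else 0)"
    unfolding F(5) sum_distrib_right using F by (intro sum.cong) auto
  then show "p * f = f" using F(1) assms by simp
qed

text \<open>Induction on the dimension of the corner: both parts of \<open>p = q + (p - q)\<close>
  have a strictly smaller corner.\<close>

lemma orthogonal_decomposition_exists:
  fixes S :: "'a::cstar_algebra set"
  assumes fd: "finite_dimensional TYPE('a)" and S: "unital_cstar_subalgebra S"
  shows "p \<in> S \<Longrightarrow> projection p \<Longrightarrow> \<exists>F. orthogonal_decomposition S F p"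
proof (induction "complex_space.dim (corner S p)" arbitrary: p rule: less_induct)
  case less
  consider "p = 0" | "minimal_projection S p" | "p \<noteq> 0" "\<not> minimal_projection S p" by blast
  then show ?case
  proof cases
    case 1
    then have "orthogonal_decomposition S {} p" by (simp add: orthogonal_decomposition_def)
    then show ?thesis by blast
  next
    case 2
    then have "orthogonal_decomposition S {p} p" by (simp add: orthogonal_decomposition_def)
    then show ?thesis by blast
  next
    case 3
    obtain q where q: "q \<in> S" "projection q" "q \<noteq> 0" "q \<noteq> p" "q * p = q"
      using nonminimal_projection_splits[OF fd S less.prems 3] by blast
    define q' where "q' = p - q"
    have q': "q' \<in> S" "projection q'" "q' \<noteq> p" "q' * p = q'"
      using projection_diff[of p q] q less.prems subalg_diff[OF S]
      by (auto simp: q'_def left_diff_distrib projection_def)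
    have dim: "complex_space.dim (corner S r) < complex_space.dim (corner S p)"
      if "r \<in> S" "projection r" "r \<noteq> p" "r * p = r" for r
      using that less.prems
      by (intro dim_strict_mono[OF fd] corner_subspace[OF S] corner_psubset[OF S])
    obtain F where F: "orthogonal_decomposition S F q" using less.hyps[OF dim] q by blast
    obtain F' where F': "orthogonal_decomposition S F' q'" using less.hyps[OF dim] q' by blast
    have qq: "q * q' = 0" "q' * q = 0"
      using subprojection_commute[OF less.prems(2) q(2,5)] q(2,5)
      by (auto simp: q'_def algebra_simps projection_def)
    have orth: "f * g = 0" "g * f = 0" if "f \<in> F" "g \<in> F'" for f g
    proof -
      note a = orthogonal_decomposition_below[OF F that(1)] orthogonal_decomposition_below[OF F' that(2)]
      have "f * g = f * (q * q') * g" by (metis a(1,4) mult.assoc)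
      then show "f * g = 0" by (simp add: qq)
      have "g * f = g * (q' * q) * f" by (metis a(2,3) mult.assoc)
      then show "g * f = 0" by (simp add: qq)
    qed
    \<comment> \<open>The decomposition sums over a set, so a common element would be counted only
      once; orthogonality excludes it.\<close>
    have "F \<inter> F' = {}"
    proof (rule ccontr)
      assume "F \<inter> F' \<noteq> {}"
      then obtain f where "f \<in> F" "f \<in> F'" by blast
      then have "f * f = 0" "minimal_projection S f"
        using orth F by (auto simp: orthogonal_decomposition_def)
      then show False by (auto simp: minimal_projection_def projection_def)
    qed
    then have "orthogonal_decomposition S (F \<union> F') p"
      using F F' orth by (auto simp: orthogonal_decomposition_def sum.union_disjoint q'_def)
    then show ?thesis by blast
  qed
qed

lemma minimal_projection_below:
  fixes S :: "'a::cstar_algebra set"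
  assumes fd: "finite_dimensional TYPE('a)" and S: "unital_cstar_subalgebra S"
    and "p \<in> S" "projection p" "p \<noteq> 0"
  shows "\<exists>q. minimal_projection S q \<and> q * p = q \<and> p * q = q"
proof -
  obtain F where F: "orthogonal_decomposition S F p"
    using orthogonal_decomposition_exists[OF fd S] assms by blast
  then obtain f where "f \<in> F" using assms(5) by (force simp: orthogonal_decomposition_def)
  then show ?thesis using F orthogonal_decomposition_below[OF F]
    by (auto simp: orthogonal_decomposition_def)
qed

text \<open>The form in which orthogonality is used later: each factor absorbs an element on its
  inner side, and these two multiply to zero.\<close>

lemma mult_eq_0_via:
  fixes a :: "'a::cstar_algebra"
  assumes "a * p = a" "q * b = b" "p * q = 0" shows "a * b = 0"
proof -
  have "a * b = a * p * (q * b)" by (simp add: assms)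
  also have "\<dots> = a * (p * q) * b" by (simp only: mult.assoc)
  finally show ?thesis by (simp add: assms)
qed

text \<open>For a minimal projection \<open>p\<close> this is the pure state supported by
  \<open>p\<close>. The algebra is not a parameter, so the same functional serves \<open>B\<close>
  and the ambient algebra.\<close>

definition corner_coeff :: "'a::cstar_algebra \<Rightarrow> 'a \<Rightarrow> complex" where
  "corner_coeff p x = (THE c. p * x * p = scaleC c p)"

lemma corner_coeff_eqI: "p \<noteq> 0 \<Longrightarrow> p * x * p = scaleC c p \<Longrightarrow> corner_coeff p x = c"
  unfolding corner_coeff_def by (rule the_equality) auto

lemma minimal_projectionD:
  assumes "minimal_projection S p"
  shows "p \<in> S" "p * p = p" "star p = p" "p \<noteq> 0" "projection p"
  using assms by (auto simp: minimal_projection_def projection_def)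

lemma corner_coeff:
  assumes "minimal_projection S p" "x \<in> S"
  shows "p * x * p = scaleC (corner_coeff p x) p"
proof -
  obtain c where "p * x * p = scaleC c p" using assms by (auto simp: minimal_projection_def)
  then show ?thesis using corner_coeff_eqI minimal_projectionD(4)[OF assms(1)] by metis
qed

lemma corner_coeff_star:
  assumes "minimal_projection S p" "x \<in> S"
  shows "corner_coeff p (star x) = cnj (corner_coeff p x)"
proof -
  have "star (p * x * p) = scaleC (cnj (corner_coeff p x)) p"
    unfolding corner_coeff[OF assms] by (simp add: minimal_projectionD[OF assms(1)])
  then show ?thesis
    by (intro corner_coeff_eqI) (simp_all add: minimal_projectionD[OF assms(1)] star_mult mult.assoc)
qed

lemma corner_coeff_add:
  assumes "minimal_projection S p" "x \<in> S" "y \<in> S"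
  shows "corner_coeff p (x + y) = corner_coeff p x + corner_coeff p y"
  by (intro corner_coeff_eqI)
    (simp_all add: minimal_projectionD[OF assms(1)] distrib_left distrib_right scaleC_add_left
      corner_coeff[OF assms(1)] assms)

lemma corner_coeff_scaleC:
  assumes "minimal_projection S p" "x \<in> S"
  shows "corner_coeff p (scaleC c x) = c * corner_coeff p x"
  by (intro corner_coeff_eqI)
    (simp_all add: minimal_projectionD[OF assms(1)] corner_coeff[OF assms(1)] assms)

lemma corner_coeff_0 [simp]: "p \<noteq> 0 \<Longrightarrow> corner_coeff p 0 = 0"
  by (intro corner_coeff_eqI) auto

lemma corner_coeff_sum:
  assumes "minimal_projection UNIV p"
  shows "corner_coeff p (sum x I) = (\<Sum>i\<in>I. corner_coeff p (x i))"
  by (induction I rule: infinite_finite_induct)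
    (simp_all add: minimal_projectionD[OF assms] corner_coeff_add[OF assms])

text \<open>On \<open>S p\<close> the form \<open>(x, y) \<mapsto> y\<^sup>* x \<in> \<complex> p\<close> is anisotropic by the C*-identity and positive at \<open>p\<close>;
  a negative vector could be combined with \<open>p\<close> to an isotropic one.\<close>

lemma corner_coeff_star_mult_nonneg:
  assumes S: "unital_cstar_subalgebra S" and p: "minimal_projection S p" and x: "x \<in> S"
  shows "Im (corner_coeff p (star x * x)) = 0" "Re (corner_coeff p (star x * x)) \<ge> 0"
proof -
  note pD = minimal_projectionD[OF p]
  define c where "c = corner_coeff p (star x * x)"
  have sxx: "star x * x \<in> S" by (intro subalg_closed[OF S] x)
  have c: "p * (star x * x) * p = scaleC c p" unfolding c_def by (rule corner_coeff[OF p sxx])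
  have "cnj c = c"
    using corner_coeff_star[OF p sxx] by (simp add: c_def star_mult)
  then show im: "Im c = 0" by (metis complex_cnj complex_surj complex.sel(2) neg_equal_zero)
  show "Re c \<ge> 0"
  proof (rule ccontr)
    assume "\<not> Re c \<ge> 0"
    define m where "m = corner_coeff p x"
    have m: "p * x * p = scaleC m p" unfolding m_def by (rule corner_coeff[OF p x])
    have sm: "p * star x * p = scaleC (cnj m) p"
      using arg_cong[OF m, of star] by (simp add: star_mult pD mult.assoc)
    define n where "n = (cmod m)\<^sup>2 - Re c"
    have n: "n > 0" using \<open>\<not> Re c \<ge> 0\<close> zero_le_power2[of "cmod m"] unfolding n_def by linarith
    \<comment> \<open>The coefficient of \<open>star w * w\<close> is
      \<open>c - |m|^2 + |k + m|^2\<close>. The choice \<open>k + m = sqrt n\<close> makes it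
      vanish, although \<open>p * w * p\<close> is \<open>sqrt n\<close> times
      \<open>p\<close>.\<close>
    define k where "k = complex_of_real (sqrt n) - m"
    define w where "w = x * p + scaleC k p"
    have "star w * w = p * (star x * x) * p + scaleC k (p * star x * p) + scaleC (cnj k) (p * x * p)
      + scaleC (cnj k * k) p"
      by (simp add: w_def star_mult pD algebra_simps)
    also have "\<dots> = scaleC (c + k * cnj m + cnj k * m + cnj k * k) p"
      by (simp add: c m sm scaleC_add_left mult.commute)
    also have "c + k * cnj m + cnj k * m + cnj k * k = c - m * cnj m + complex_of_real (sqrt n) ^ 2"
      by (simp add: k_def algebra_simps power2_eq_square)
    also have "complex_of_real (sqrt n) ^ 2 = complex_of_real n"
      using n by (simp flip: of_real_power)
    also have "c - m * cnj m + complex_of_real n = 0"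
      unfolding n_def cmod_power2 using im by (simp add: complex_eq_iff power2_eq_square)
    finally have "w = 0" by simp
    then have "p * w * p = 0" by simp
    moreover have "p * w * p = p * x * p + scaleC k p" by (simp add: w_def distrib_left distrib_right mult.assoc pD)
    ultimately have "scaleC (complex_of_real (sqrt n)) p = 0"
      by (simp add: m k_def flip: scaleC_add_left)
    then show False using n pD by simp
  qed
qed

text \<open>This is the C*-identity for \<open>x * p\<close>: the null space of the state is the
  left ideal of all \<open>x\<close> with \<open>x * p = 0\<close>.\<close>

lemma corner_coeff_star_mult_eq_0_iff:
  assumes S: "unital_cstar_subalgebra S" and p: "minimal_projection S p" and x: "x \<in> S"
  shows "corner_coeff p (star x * x) = 0 \<longleftrightarrow> x * p = 0"
proof -
  note pD = minimal_projectionD[OF p]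
  have "star (x * p) * (x * p) = scaleC (corner_coeff p (star x * x)) p"
    using corner_coeff[OF p, of "star x * x"] subalg_closed[OF S] x
    by (simp add: star_mult pD mult.assoc)
  then show ?thesis using pD star_mult_self_eq_0_iff[of "x * p"] by (auto simp del: star_mult_self_eq_0_iff)
qed

section \<open>Matrix units\<close>

text \<open>\<open>r f\<close> is a representative of the class of \<open>f\<close> under Murray-von Neumann equivalence in \<open>S\<close>, and
  \<open>v f\<close> a partial isometry from \<open>r f\<close> to \<open>f\<close>; it need not satisfy \<open>v (r f) = r f\<close>.\<close>

locale matrix_units =
  fixes S F :: "'a::cstar_algebra set" and r v :: "'a \<Rightarrow> 'a"
  assumes S: "unital_cstar_subalgebra S"
    and F: "orthogonal_decomposition S F 1"
    and r_in [simp]: "f \<in> F \<Longrightarrow> r f \<in> F"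
    and v_in: "f \<in> F \<Longrightarrow> v f \<in> S"
    and v_left [simp]: "f \<in> F \<Longrightarrow> f * v f = v f"
    and star_v_mult_v [simp]: "f \<in> F \<Longrightarrow> star (v f) * v f = r f"
    and v_mult_star_v [simp]: "f \<in> F \<Longrightarrow> v f * star (v f) = f"
    and inequivalent: "f \<in> F \<Longrightarrow> g \<in> F \<Longrightarrow> r f \<noteq> r g \<Longrightarrow> x \<in> S \<Longrightarrow> f * x * g = 0"

text \<open>For minimal projections, a nonzero element \<open>f * x * g\<close> with
  \<open>x\<close> in \<open>S\<close> is a partial isometry up to a scalar. The relation
  \<open>rel\<close> is therefore Murray-von Neumann equivalence.\<close>

lemma matrix_units_exist:
  assumes S: "unital_cstar_subalgebra S" and F: "orthogonal_decomposition S F 1"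
  shows "\<exists>r v. matrix_units S F r v"
proof -
  define rel where "rel f g \<longleftrightarrow> (\<exists>x\<in>S. f * x * g \<noteq> 0)" for f g
  have min: "minimal_projection S f" if "f \<in> F" for f
    using that F by (auto simp: orthogonal_decomposition_def)
  note mD = minimal_projectionD[OF min]
  have refl: "rel f f" if "f \<in> F" for f
    unfolding rel_def using subalg_one[OF S] mD[OF that] by (intro bexI[of _ 1]) auto
  have sym: "rel g f" if "f \<in> F" "g \<in> F" "rel f g" for f g
  proof -
    obtain x where x: "x \<in> S" "f * x * g \<noteq> 0" using \<open>rel f g\<close> by (auto simp: rel_def)
    then have "star (f * x * g) \<noteq> 0" by simp
    then have "g * star x * f \<noteq> 0" using mD that by (simp add: star_mult mult.assoc)
    then show ?thesis unfolding rel_def using x subalg_star[OF S] by blast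
  qed
  \<comment> \<open>Multiplying \<open>f x g y h\<close> on the left by the adjoint of
    \<open>f x g\<close> returns a nonzero multiple of \<open>g y h\<close>.\<close>
  have trans: "rel f h" if fgh: "f \<in> F" "g \<in> F" "h \<in> F" and "rel f g" "rel g h" for f g h
  proof -
    obtain x y where xy: "x \<in> S" "f * x * g \<noteq> 0" "y \<in> S" "g * y * h \<noteq> 0"
      using \<open>rel f g\<close> \<open>rel g h\<close> by (auto simp: rel_def)
    have fx: "f * x \<in> S" by (intro subalg_closed[OF S] xy mD fgh)
    define c where "c = corner_coeff g (star (f * x) * (f * x))"
    have "c \<noteq> 0"
      unfolding c_def using corner_coeff_star_mult_eq_0_iff[OF S min[OF fgh(2)] fx] xy by simp
    have "g * (star (f * x) * (f * x)) * g = scaleC c g"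
      unfolding c_def by (intro corner_coeff[OF min[OF fgh(2)]] subalg_closed[OF S] fx)
    then have "star (f * x * g) * (f * (x * g * y) * h) = scaleC c (g * y * h)"
      by (simp add: star_mult mD fgh mult.assoc) (simp flip: mult.assoc add: mD fgh)
    then have "f * (x * g * y) * h \<noteq> 0" using \<open>c \<noteq> 0\<close> xy by auto
    moreover have "x * g * y \<in> S" by (intro subalg_closed[OF S] xy mD fgh)
    ultimately show ?thesis unfolding rel_def by blast
  qed
  define r where "r f = (SOME g. g \<in> F \<and> rel f g)" for f
  have r: "r f \<in> F" "rel f (r f)" if "f \<in> F" for f
    using someI[of "\<lambda>g. g \<in> F \<and> rel f g", OF conjI[OF that refl[OF that]]] by (auto simp: r_def)
  have r_eq: "r f = r g" if "f \<in> F" "g \<in> F" "rel f g" for f g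
  proof -
    \<comment> \<open>Equivalent projections pose the same choice problem, and \<open>SOME\<close>
      answers equal predicates equally.\<close>
    have "(\<lambda>h. h \<in> F \<and> rel f h) = (\<lambda>h. h \<in> F \<and> rel g h)"
      using that sym trans by blast
    then show ?thesis by (simp add: r_def)
  qed
  have "\<exists>u\<in>S. f * u = u \<and> star u * u = r f \<and> u * star u = f" if f: "f \<in> F" for f
  proof -
    obtain x where x: "x \<in> S" "f * x * r f \<noteq> 0" using r[OF f] by (auto simp: rel_def)
    have fx: "f * x \<in> S" by (intro subalg_closed[OF S] x mD f)
    define c where "c = corner_coeff (r f) (star (f * x) * (f * x))"
    have "c \<noteq> 0" unfolding c_def
      using corner_coeff_star_mult_eq_0_iff[OF S min[OF r(1)[OF f]] fx] x by simp
    moreover have "Im c = 0" "Re c \<ge> 0"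
      using corner_coeff_star_mult_nonneg[OF S min[OF r(1)[OF f]] fx] by (auto simp: c_def)
    ultimately have c: "c = complex_of_real (Re c)" "Re c > 0"
      by (auto simp: complex_eq_iff less_le)
    \<comment> \<open>The inverse square root of \<open>c\<close>, so that \<open>star u * u\<close>
      becomes exactly \<open>r f\<close>.\<close>
    define k where "k = complex_of_real (1 / sqrt (Re c))"
    have k: "k * (k * c) = 1" "cnj k = k"
      using c by (auto simp: k_def simp flip: of_real_mult intro!: complex_eqI)
    define u where "u = scaleC k (f * x * r f)"
    have "r f * (star (f * x) * (f * x)) * r f = scaleC c (r f)"
      unfolding c_def by (intro corner_coeff[OF min[OF r(1)[OF f]]] subalg_closed[OF S] fx)
    then have uu: "star u * u = r f"
      by (simp add: u_def star_mult mult.assoc mD r f k)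
    have fu: "f * u = u" by (simp add: u_def mD f flip: mult.assoc)
    have ur: "u * r f = u" by (simp add: u_def mult.assoc mD r f)
    have uS: "u \<in> S" unfolding u_def by (intro subalg_closed[OF S] x mD f r)
    have "u \<noteq> 0" using uu mD(4)[OF r(1)[OF f]] by auto
    \<comment> \<open>By minimality \<open>u * star u\<close> is \<open>d\<close> times
      \<open>f\<close>; it is idempotent and nonzero, which leaves \<open>d = 1\<close>.\<close>
    define d where "d = corner_coeff f (u * star u)"
    have uf: "star u * f = star u" using arg_cong[OF fu, of star] by (simp add: star_mult mD f)
    have "f * (u * star u) * f = scaleC d f" unfolding d_def
      by (intro corner_coeff[OF min[OF f]] subalg_closed[OF S] uS)
    then have d: "u * star u = scaleC d f" by (simp add: mult.assoc uf) (simp add: fu flip: mult.assoc)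
    have "(u * star u) * (u * star u) = u * (star u * u) * star u" by (simp add: mult.assoc)
    then have "scaleC (d * d) f = scaleC d f" by (simp add: uu ur d mD f)
    moreover have "u * star u \<noteq> 0" using star_mult_self_eq_0_iff[of "star u"] \<open>u \<noteq> 0\<close> by auto
    ultimately have "d = 1" using mD[OF f] d by auto
    then show ?thesis using uS fu uu d by auto
  qed
  then obtain v where "\<And>f. f \<in> F \<Longrightarrow> v f \<in> S \<and> f * v f = v f \<and> star (v f) * v f = r f \<and> v f * star (v f) = f"
    by metis
  then have "matrix_units S F r v"
    using r_eq r by unfold_locales (auto simp: S F rel_def)
  then show ?thesis by blast
qed

context matrix_units
begin

lemma finite_F [simp]: "finite F"
  and min: "f \<in> F \<Longrightarrow> minimal_projection S f"
  and orthogonal: "f \<in> F \<Longrightarrow> g \<in> F \<Longrightarrow> f \<noteq> g \<Longrightarrow> f * g = 0"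
  and sum_F [simp]: "\<Sum>F = 1"
  using F by (auto simp: orthogonal_decomposition_def)

lemmas minD = minimal_projectionD[OF min]

lemma idem [simp]: "f \<in> F \<Longrightarrow> f * f = f" and star_F [simp]: "f \<in> F \<Longrightarrow> star f = f"
  and F_nonzero [simp]: "f \<in> F \<Longrightarrow> f \<noteq> 0" and F_in: "f \<in> F \<Longrightarrow> f \<in> S"
  using minD by auto

lemma v_right [simp]: "f \<in> F \<Longrightarrow> v f * r f = v f"
  by (metis mult.assoc star_v_mult_v v_left v_mult_star_v)

lemma star_v_left [simp]: "f \<in> F \<Longrightarrow> r f * star (v f) = star (v f)"
  by (metis r_in star_F star_mult v_right)

lemma star_v_right [simp]: "f \<in> F \<Longrightarrow> star (v f) * f = star (v f)"
  by (metis star_F star_mult v_left)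

lemma star_v_mult_v_ne [simp]: "f \<in> F \<Longrightarrow> g \<in> F \<Longrightarrow> f \<noteq> g \<Longrightarrow> star (v f) * v g = 0"
  by (rule mult_eq_0_via[OF star_v_right v_left orthogonal])

lemma v_nonzero [simp]: "f \<in> F \<Longrightarrow> v f \<noteq> 0"
  by (metis F_nonzero mult_zero_left v_mult_star_v)

lemma decompose: "x = (\<Sum>f\<in>F. \<Sum>g\<in>F. f * x * g)"
proof -
  have "(\<Sum>f\<in>F. \<Sum>g\<in>F. f * x * g) = (\<Sum>f\<in>F. f * x * \<Sum>F)" by (simp only: sum_distrib_left)
  also have "\<dots> = \<Sum>F * x * \<Sum>F" by (simp only: sum_distrib_right)
  finally show ?thesis by simp
qed

lemma eqI_right: "(\<And>f. f \<in> F \<Longrightarrow> x * f = y * f) \<Longrightarrow> x = y"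
proof -
  assume *: "\<And>f. f \<in> F \<Longrightarrow> x * f = y * f"
  have "x = (\<Sum>f\<in>F. x * f)" by (simp flip: sum_distrib_left)
  also have "\<dots> = (\<Sum>f\<in>F. y * f)" using * by simp
  also have "\<dots> = y" by (simp flip: sum_distrib_left)
  finally show ?thesis .
qed

text \<open>Matrix units inside each class; between different classes they are zero, so that double
  sums may run over all of \<open>F\<close>.\<close>

definition e :: "'a \<Rightarrow> 'a \<Rightarrow> 'a" where
  "e f g = v f * star (v g)"

lemma e_in: "f \<in> F \<Longrightarrow> g \<in> F \<Longrightarrow> e f g \<in> S"
  unfolding e_def by (intro subalg_closed[OF S] v_in)

lemma star_e [simp]: "star (e f g) = e g f"
  by (simp add: e_def star_mult)

lemma e_diag [simp]: "f \<in> F \<Longrightarrow> e f f = f"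
  by (simp add: e_def)

lemma e_eq_0: "f \<in> F \<Longrightarrow> g \<in> F \<Longrightarrow> r f \<noteq> r g \<Longrightarrow> e f g = 0"
  unfolding e_def by (rule mult_eq_0_via[OF v_right star_v_left orthogonal]) auto

lemma e_nonzero: "f \<in> F \<Longrightarrow> g \<in> F \<Longrightarrow> r f = r g \<Longrightarrow> e f g \<noteq> 0"
proof
  assume *: "f \<in> F" "g \<in> F" "r f = r g" "e f g = 0"
  have "e f g * v g = v f * (star (v g) * v g)" by (simp add: e_def mult.assoc)
  also have "\<dots> = v f" using * by simp (metis v_right)
  finally show False using * by simp
qed

lemma e_mult_e:
  assumes "f \<in> F" "g \<in> F" "h \<in> F" "k \<in> F" "r f = r g"
  shows "e f g * e h k = (if g = h then e f k else 0)"
proof -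
  have "e f g * e h k = v f * (star (v g) * v h) * star (v k)" by (simp add: e_def mult.assoc)
  then show ?thesis using assms by (auto simp: e_def) (metis v_right)
qed

lemma e_left [simp]: "f \<in> F \<Longrightarrow> f * e f g = e f g"
  by (simp add: e_def flip: mult.assoc)

lemma e_right [simp]: "g \<in> F \<Longrightarrow> e f g * g = e f g"
  by (simp add: e_def mult.assoc)

text \<open>The matrix entry of \<open>x\<close> at \<open>(f, g)\<close>, computed in the corner of
  the common representative. For inequivalent \<open>f\<close> and \<open>g\<close> the value is
  immaterial, because \<open>e f g\<close> is then zero.\<close>

definition coefficient :: "'a \<Rightarrow> 'a \<Rightarrow> 'a \<Rightarrow> complex" where
  "coefficient f g x = corner_coeff (r f) (star (v f) * x * v g)"

lemma v_conj:
  assumes "f \<in> F" "g \<in> F" "r f = r g" "x \<in> S"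
  shows "star (v f) * x * v g = scaleC (coefficient f g x) (r f)"
proof -
  have "r f * (star (v f) * x * v g) * r f = scaleC (coefficient f g x) (r f)"
    unfolding coefficient_def using assms
    by (intro corner_coeff[OF min] subalg_closed[OF S] v_in) auto
  moreover have "r f * (star (v f) * x * v g) * r f = (r f * star (v f)) * x * (v g * r f)"
    by (simp add: mult.assoc)
  moreover have "r f * star (v f) = star (v f)" "v g * r f = v g"
    using star_v_left[of f] v_right[of g] assms(1-3) by simp_all
  ultimately show ?thesis by simp
qed

lemma corner_eq:
  assumes "f \<in> F" "g \<in> F" "x \<in> S"
  shows "f * x * g = scaleC (coefficient f g x) (e f g)"
proof (cases "r f = r g")
  case True
  have "f * x * g = v f * star (v f) * x * (v g * star (v g))" using assms by simp
  also have "\<dots> = v f * (star (v f) * x * v g) * star (v g)" by (simp add: mult.assoc)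
  also have "\<dots> = scaleC (coefficient f g x) (e f g)"
    using assms by (simp add: v_conj True e_def) (metis True v_right)
  finally show ?thesis .
next
  case False
  then show ?thesis using assms by (simp add: inequivalent e_eq_0)
qed

lemma coefficient_eqI:
  assumes "f \<in> F" "g \<in> F" "r f = r g" "x \<in> S" "f * x * g = scaleC c (e f g)"
  shows "coefficient f g x = c"
  using corner_eq[OF assms(1,2,4)] e_nonzero[OF assms(1-3)] assms(5) by simp

lemma expand:
  assumes "x \<in> S" shows "x = (\<Sum>f\<in>F. \<Sum>g\<in>F. scaleC (coefficient f g x) (e f g))"
  using decompose[of x] corner_eq assms by simp

text \<open>The states at all \<open>f\<close> are nonnegative on both summands, so each summand has
  state zero at every \<open>f\<close>, which gives \<open>a * f = 0\<close>.\<close>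

lemma star_mult_add_eq_0D:
  assumes "a \<in> S" "b \<in> S" "star a * a + star b * b = 0"
  shows "a = 0"
proof (rule eqI_right)
  fix f assume f: "f \<in> F"
  have in_S: "star a * a \<in> S" "star b * b \<in> S" by (intro subalg_closed[OF S] assms)+
  have "corner_coeff f (star a * a) + corner_coeff f (star b * b) = 0"
    using corner_coeff_add[OF min[OF f] in_S] f assms(3) by simp
  moreover note corner_coeff_star_mult_nonneg[OF S min[OF f] assms(1)]
    corner_coeff_star_mult_nonneg[OF S min[OF f] assms(2)]
  ultimately have "corner_coeff f (star a * a) = 0"
    by (auto simp: complex_eq_iff)
  then show "a * f = 0 * f"
    using corner_coeff_star_mult_eq_0_iff[OF S min[OF f] assms(1)] by simp
qed

end

section \<open>Conditional expectations\<close>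

lemma sum_insert_form:
  fixes G :: "'i \<Rightarrow> 'i \<Rightarrow> complex"
  assumes "finite I" "a \<notin> I" and herm: "\<And>i. i \<in> I \<Longrightarrow> G i a = cnj (G a i)"
  shows "(\<Sum>i\<in>insert a I. \<Sum>j\<in>insert a I. cnj (c i) * G i j * c j) =
    cnj (c a) * G a a * c a + cnj (c a) * (\<Sum>j\<in>I. G a j * c j) + c a * cnj (\<Sum>j\<in>I. G a j * c j)
    + (\<Sum>i\<in>I. \<Sum>j\<in>I. cnj (c i) * G i j * c j)"
  using assms by (simp add: sum.distrib sum_distrib_left algebra_simps)

text \<open>Cholesky factorisation by induction on the index set. The inner index of the factor
  ranges over the same set \<open>I\<close>, which later allows it to be read as a square matrix
  over \<open>B\<close>.\<close>

lemma gram_matrix_exists: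
  fixes G :: "'i \<Rightarrow> 'i \<Rightarrow> complex"
  assumes "finite I" "\<And>i j. i \<in> I \<Longrightarrow> j \<in> I \<Longrightarrow> G j i = cnj (G i j)"
    and "\<And>c. 0 \<le> Re (\<Sum>i\<in>I. \<Sum>j\<in>I. cnj (c i) * G i j * c j)"
  shows "\<exists>C. \<forall>i\<in>I. \<forall>j\<in>I. G i j = (\<Sum>k\<in>I. cnj (C k i) * C k j)"
  using assms
proof (induction I arbitrary: G rule: finite_induct)
  case (insert a I)
  note herm = insert.prems(1)
  define L where "L c = (\<Sum>j\<in>I. G a j * c j)" for c :: "'i \<Rightarrow> complex"
  define Q where "Q c = (\<Sum>i\<in>I. \<Sum>j\<in>I. cnj (c i) * G i j * c j)" for c :: "'i \<Rightarrow> complex"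
  have pos: "0 \<le> Re (cnj t * G a a * t + cnj t * L c + t * cnj (L c) + Q c)" for t c
  proof -
    let ?c = "c(a := t)"
    have "L ?c = L c" "Q ?c = Q c" unfolding L_def Q_def
      using insert.hyps by (auto intro!: sum.cong)
    moreover have "G i a = cnj (G a i)" if "i \<in> I" for i
      by (rule herm) (use that in auto)
    note sum_insert_form[of I a G ?c, OF insert.hyps(1,2) this]
    ultimately show ?thesis
      using insert.prems(2)[of ?c] by (simp only: L_def Q_def fun_upd_same)
  qed
  define g where "g = Re (G a a)"
  have Gaa: "G a a = complex_of_real g"
    using herm[of a a] by (simp add: g_def complex_eq_iff)
  have "g \<ge> 0" using pos[of 1 "\<lambda>_. 0"] by (simp add: Gaa L_def Q_def)
  show ?case
  proof (cases "g = 0")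
    case True
    have L0: "L c = 0" for c
    proof (rule ccontr)
      assume "L c \<noteq> 0"
      \<comment> \<open>Scaled so that the real part of the form at \<open>t = - s * L c\<close> is
        -1.\<close>
      define s where "s = (Re (Q c) + 1) / (2 * (cmod (L c))\<^sup>2)"
      have "cnj (- of_real s * L c) * L c + (- of_real s * L c) * cnj (L c)
        = of_real (- 2 * s * (cmod (L c))\<^sup>2)"
        by (simp add: complex_norm_square[symmetric] mult.assoc mult.commute del: of_real_power)
      moreover have "2 * s * (cmod (L c))\<^sup>2 = Re (Q c) + 1"
        using \<open>L c \<noteq> 0\<close> by (simp add: s_def)
      ultimately show False using pos[of "- of_real s * L c" c] by (simp add: Gaa True)
    qed
    have G0: "G a j = 0" if "j \<in> I" for j
      using L0[of "\<lambda>i. if i = j then 1 else 0"] that insert.hyps by (simp add: L_def if_distrib cong: if_cong)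
    have "\<exists>C. \<forall>i\<in>I. \<forall>j\<in>I. G i j = (\<Sum>k\<in>I. cnj (C k i) * C k j)"
    proof (rule insert.IH)
      show "G j i = cnj (G i j)" if "i \<in> I" "j \<in> I" for i j
        by (rule herm) (use that in auto)
      show "0 \<le> Re (\<Sum>i\<in>I. \<Sum>j\<in>I. cnj (c i) * G i j * c j)" for c
        using pos[of 0 c] by (simp add: Q_def)
    qed
    then obtain C where C: "\<And>i j. i \<in> I \<Longrightarrow> j \<in> I \<Longrightarrow> G i j = (\<Sum>k\<in>I. cnj (C k i) * C k j)"
      by blast
    define C' where "C' k i = (if k = a \<or> i = a then 0 else C k i)" for k i
    have "G i j = (\<Sum>k\<in>insert a I. cnj (C' k i) * C' k j)" if "i \<in> insert a I" "j \<in> insert a I" for i j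
    proof (cases "i = a \<or> j = a")
      case True
      then have "G i j = 0" using that G0 Gaa \<open>g = 0\<close> herm[of a i] by auto
      then show ?thesis using True by (auto simp: C'_def)
    next
      case False
      then have "i \<in> I" "j \<in> I" using that by auto
      then show ?thesis using False insert.hyps C
        by (auto simp: C'_def intro!: sum.cong)
    qed
    then show ?thesis by blast
  next
    case False
    with \<open>g \<ge> 0\<close> have g: "g > 0" by simp
    \<comment> \<open>Schur complement of the entry at \<open>(a, a)\<close>. Its form is that of
      \<open>G\<close> with \<open>t = - L c / g\<close> inserted, the value of \<open>t\<close>
      that minimises it.\<close>
    define H where "H i j = G i j - cnj (G a i) * G a j / of_real g" for i j
    have "\<exists>C. \<forall>i\<in>I. \<forall>j\<in>I. H i j = (\<Sum>k\<in>I. cnj (C k i) * C k j)"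
    proof (rule insert.IH)
      show "H j i = cnj (H i j)" if "i \<in> I" "j \<in> I" for i j
        using herm[of i j] that by (simp add: H_def mult.commute)
      fix c
      have LL: "cnj (L c) * L c / of_real g = (\<Sum>i\<in>I. \<Sum>j\<in>I. cnj (G a i * c i) * (G a j * c j) / of_real g)"
        by (simp only: L_def cnj_sum sum_product sum_divide_distrib)
      have "(\<Sum>i\<in>I. \<Sum>j\<in>I. cnj (c i) * H i j * c j) = Q c - cnj (L c) * L c / of_real g"
        unfolding LL Q_def sum_subtractf[symmetric]
        by (intro sum.cong refl) (simp add: H_def algebra_simps)
      also have "\<dots> = cnj (- L c / of_real g) * G a a * (- L c / of_real g)
         + cnj (- L c / of_real g) * L c + (- L c / of_real g) * cnj (L c) + Q c"
        using g by (simp add: Gaa field_simps)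
      finally show "0 \<le> Re (\<Sum>i\<in>I. \<Sum>j\<in>I. cnj (c i) * H i j * c j)" using pos by metis
    qed
    then obtain C where C: "\<And>i j. i \<in> I \<Longrightarrow> j \<in> I \<Longrightarrow> H i j = (\<Sum>k\<in>I. cnj (C k i) * C k j)"
      by blast
    \<comment> \<open>Row \<open>a\<close> of the factor accounts for the subtracted rank-one part;
      the other rows vanish in column \<open>a\<close>.\<close>
    define C' where "C' k i = (if k = a then G a i / of_real (sqrt g) else if i = a then 0 else C k i)" for k i
    have sq: "complex_of_real (sqrt g) * complex_of_real (sqrt g) = of_real g"
      using g by (simp flip: of_real_mult)
    have first: "cnj (C' a i) * C' a j = cnj (G a i) * G a j / of_real g" for i j
      by (simp add: C'_def sq)
    have "G i j = (\<Sum>k\<in>insert a I. cnj (C' k i) * C' k j)" if "i \<in> insert a I" "j \<in> insert a I" for i j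
    proof (cases "i = a \<or> j = a")
      case True
      then have "(\<Sum>k\<in>I. cnj (C' k i) * C' k j) = 0"
        using insert.hyps by (intro sum.neutral) (auto simp: C'_def)
      moreover have "G i j = cnj (G a i) * G a j / of_real g"
        using True herm[of a i] that g by (auto simp: Gaa)
      ultimately show ?thesis using insert.hyps by (simp add: first)
    next
      case False
      then have ij: "i \<in> I" "j \<in> I" using that by auto
      have "(\<Sum>k\<in>I. cnj (C' k i) * C' k j) = H i j"
        unfolding C[OF ij] using False insert.hyps by (intro sum.cong) (auto simp: C'_def)
      then show ?thesis using insert.hyps by (simp add: first H_def)
    qed
    then show ?thesis by blast
  qed
qed simp

section \<open>Expectations built from pure states\<close>

lemma sum_rotate:
  "(\<Sum>i\<in>I. \<Sum>j\<in>J. \<Sum>k\<in>K. f i j k) = (\<Sum>k\<in>K. \<Sum>i\<in>I. \<Sum>j\<in>J. f i j k :: 'a::comm_monoid_add)"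
proof -
  have "(\<Sum>i\<in>I. \<Sum>j\<in>J. \<Sum>k\<in>K. f i j k) = (\<Sum>i\<in>I. \<Sum>k\<in>K. \<Sum>j\<in>J. f i j k)"
    by (rule sum.cong[OF refl sum.swap])
  also have "\<dots> = (\<Sum>k\<in>K. \<Sum>i\<in>I. \<Sum>j\<in>J. f i j k)" by (rule sum.swap)
  finally show ?thesis .
qed

lemma star_transpose_mult_index:
  assumes "Y \<in> carrier_mat m m" "s < m" "t < m"
  shows "(map_mat star (transpose_mat Y) * Y) $$ (s, t) = (\<Sum>k<m. star (Y $$ (k, s)) * (Y $$ (k, t)))"
  using assms by (simp add: scalar_prod_def atLeast0LessThan)

text \<open>A choice of a minimal projection of the ambient algebra below each representative. This
  is the freedom from which different expectations arise.\<close>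

locale expectation_data = matrix_units B F r v for B F :: "'a::cstar_algebra set" and r v +
  fixes q :: "'a \<Rightarrow> 'a"
  assumes q_min: "f \<in> F \<Longrightarrow> minimal_projection UNIV (q (r f))"
    and q_below [simp]: "f \<in> F \<Longrightarrow> q (r f) * r f = q (r f)"
begin

text \<open>The block of a class is a matrix algebra over the ambient corner of its representative,
  and the state at \<open>q (r f)\<close> is applied entrywise. Blocks between different classes are
  discarded because \<open>e f g = 0\<close> there.\<close>

definition E :: "'a \<Rightarrow> 'a" where
  "E x = (\<Sum>f\<in>F. \<Sum>g\<in>F. scaleC (corner_coeff (q (r f)) (star (v f) * x * v g)) (e f g))"

lemma q_below' [simp]: "f \<in> F \<Longrightarrow> r f * q (r f) = q (r f)"
  using minimal_projectionD[OF q_min] q_below by (metis r_in star_F star_mult)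

lemma E_in: "E x \<in> B"
  unfolding E_def by (intro subalg_closed[OF S] e_in)

lemma E_add: "E (x + y) = E x + E y"
proof -
  have "corner_coeff (q (r f)) (star (v f) * (x + y) * v g) =
    corner_coeff (q (r f)) (star (v f) * x * v g) + corner_coeff (q (r f)) (star (v f) * y * v g)"
    if "f \<in> F" for f g
    by (simp add: distrib_left distrib_right corner_coeff_add[OF q_min[OF that]])
  then show ?thesis by (simp add: E_def scaleC_add_left sum.distrib)
qed

lemma E_scaleC: "E (scaleC c x) = scaleC c (E x)"
proof -
  have "corner_coeff (q (r f)) (star (v f) * scaleC c x * v g) =
    c * corner_coeff (q (r f)) (star (v f) * x * v g)"
    if "f \<in> F" for f g
    by (simp add: corner_coeff_scaleC[OF q_min[OF that]])
  then show ?thesis by (simp add: E_def complex_space.scale_sum_right)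
qed

lemma E_identity:
  assumes "b \<in> B" shows "E b = b"
proof -
  have "scaleC (corner_coeff (q (r f)) (star (v f) * b * v g)) (e f g) =
    scaleC (coefficient f g b) (e f g)" if fg: "f \<in> F" "g \<in> F" for f g
  proof (cases "r f = r g")
    case True
    have "corner_coeff (q (r f)) (star (v f) * b * v g) = coefficient f g b"
      unfolding v_conj[OF fg True assms]
      by (intro corner_coeff_eqI)
        (use q_min[OF fg(1)] fg in \<open>simp_all add: minimal_projectionD\<close>)
    then show ?thesis by simp
  next
    case False
    then show ?thesis by (simp add: e_eq_0 fg)
  qed
  then have "E b = (\<Sum>f\<in>F. \<Sum>g\<in>F. scaleC (coefficient f g b) (e f g))"
    unfolding E_def by (intro sum.cong refl)
  then show ?thesis using expand[OF assms] by (simp only:)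
qed

text \<open>Evaluated at a vector \<open>c\<close>, the form of these coefficients is a sum of
  states of \<open>star (z k) * z k\<close>, one for each row \<open>k\<close> of \<open>Y\<close>.
  It is therefore nonnegative and has a Cholesky factor.\<close>

lemma gram_coefficients:
  assumes p: "p \<in> r ` F" and Y: "Y \<in> carrier_mat m m"
    and X: "X = map_mat star (transpose_mat Y) * Y"
  shows "\<exists>C. \<forall>s<m. \<forall>t<m. \<forall>f\<in>F. \<forall>g\<in>F. r f = p \<longrightarrow> r g = p \<longrightarrow>
    corner_coeff (q p) (star (v f) * X $$ (s, t) * v g) =
    (\<Sum>u<m. \<Sum>c\<in>{c\<in>F. r c = p}. cnj (C (u, c) (s, f)) * C (u, c) (t, g))"
proof -
  have qp: "minimal_projection UNIV (q p)" using p q_min by auto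
  define I where "I = {..<m} \<times> {f\<in>F. r f = p}"
  define G where "G = (\<lambda>(s, f) (t, g). corner_coeff (q p) (star (v f) * X $$ (s, t) * v g))"
  have Xst: "X $$ (s, t) = (\<Sum>k<m. star (Y $$ (k, s)) * (Y $$ (k, t)))" if "s < m" "t < m" for s t
    unfolding X by (rule star_transpose_mult_index[OF Y that])
  have "\<exists>C. \<forall>i\<in>I. \<forall>j\<in>I. G i j = (\<Sum>k\<in>I. cnj (C k i) * C k j)"
  proof (rule gram_matrix_exists)
    show "finite I" by (simp add: I_def)
  next
    fix i j assume ij: "i \<in> I" "j \<in> I"
    obtain s f t g where [simp]: "i = (s, f)" "j = (t, g)" by (cases i, cases j)
    have "star (star (v f) * X $$ (s, t) * v g) = star (v g) * X $$ (t, s) * v f"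
      using ij Xst by (simp add: I_def star_mult mult.assoc)
    then show "G j i = cnj (G i j)"
      using corner_coeff_star[OF qp, of "star (v f) * X $$ (s, t) * v g"] by (simp add: G_def)
  next
    fix c
    define z where "z k = (\<Sum>(t, g)\<in>I. scaleC (c (t, g)) (Y $$ (k, t) * v g))" for k
    have zz: "star (z k) * z k = (\<Sum>i\<in>I. \<Sum>j\<in>I. scaleC (cnj (c i) * c j)
      (star (v (snd i)) * (star (Y $$ (k, fst i)) * Y $$ (k, fst j)) * v (snd j)))" for k
      by (simp add: z_def case_prod_beta sum_product star_mult mult.assoc mult.commute)
    have "(\<Sum>i\<in>I. \<Sum>j\<in>I. cnj (c i) * G i j * c j) = (\<Sum>k<m. corner_coeff (q p) (star (z k) * z k))"
    proof -
      have "cnj (c i) * G i j * c j = (\<Sum>k<m. corner_coeff (q p) (scaleC (cnj (c i) * c j)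
        (star (v (snd i)) * (star (Y $$ (k, fst i)) * Y $$ (k, fst j)) * v (snd j))))"
        if "i \<in> I" "j \<in> I" for i j
      proof -
        have "G i j = corner_coeff (q p) (\<Sum>k<m.
          star (v (snd i)) * (star (Y $$ (k, fst i)) * Y $$ (k, fst j)) * v (snd j))"
          using that Xst by (auto simp: G_def I_def sum_distrib_left sum_distrib_right)
        then show ?thesis
          by (simp add: corner_coeff_sum[OF qp] corner_coeff_scaleC[OF qp] sum_distrib_left
              sum_distrib_right mult_ac)
      qed
      then have "(\<Sum>i\<in>I. \<Sum>j\<in>I. cnj (c i) * G i j * c j) = (\<Sum>i\<in>I. \<Sum>j\<in>I. \<Sum>k<m.
         corner_coeff (q p) (scaleC (cnj (c i) * c j)
        (star (v (snd i)) * (star (Y $$ (k, fst i)) * Y $$ (k, fst j)) * v (snd j))))"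
        by simp
      also have "\<dots> = (\<Sum>k<m. \<Sum>i\<in>I. \<Sum>j\<in>I. corner_coeff (q p) (scaleC (cnj (c i) * c j)
        (star (v (snd i)) * (star (Y $$ (k, fst i)) * Y $$ (k, fst j)) * v (snd j))))"
        by (rule sum_rotate)
      also have "\<dots> = (\<Sum>k<m. corner_coeff (q p) (star (z k) * z k))"
        by (simp add: zz corner_coeff_sum[OF qp])
      finally show ?thesis .
    qed
    then show "0 \<le> Re (\<Sum>i\<in>I. \<Sum>j\<in>I. cnj (c i) * G i j * c j)"
      using corner_coeff_star_mult_nonneg[OF unital_UNIV qp] by (simp add: sum_nonneg)
  qed
  then obtain C where C: "\<And>i j. i \<in> I \<Longrightarrow> j \<in> I \<Longrightarrow> G i j = (\<Sum>k\<in>I. cnj (C k i) * C k j)" by blast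
  show ?thesis
  proof (intro exI[of _ C] allI impI ballI)
    fix s t f g assume "s < m" "t < m" "f \<in> F" "g \<in> F" "r f = p" "r g = p"
    then show "corner_coeff (q p) (star (v f) * X $$ (s, t) * v g) =
      (\<Sum>u<m. \<Sum>c\<in>{c\<in>F. r c = p}. cnj (C (u, c) (s, f)) * C (u, c) (t, g))"
      using C[of "(s, f)" "(t, g)"] by (simp add: G_def I_def sum.cartesian_product case_prod_beta)
  qed
qed

text \<open>The scalar factor of each class, doubly indexed by \<open>(u, c)\<close> and
  \<open>(t, g)\<close>, becomes a matrix over \<open>B\<close>: its entry \<open>(u, t)\<close>
  carries the number \<open>C p (u, c) (t, g)\<close> at the matrix unit
  \<open>e c g\<close>.\<close>

lemma E_completely_positive: "completely_positive B E"
  unfolding completely_positive_def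
proof (intro allI impI)
  fix m :: nat and X :: "'a mat" assume "mat_positive_in m UNIV X"
  then obtain Y where Y: "Y \<in> carrier_mat m m" and X: "X = map_mat star (transpose_mat Y) * Y"
    by (auto simp: mat_positive_in_def)
  have "\<forall>p\<in>r ` F. \<exists>C. \<forall>s<m. \<forall>t<m. \<forall>f\<in>F. \<forall>g\<in>F. r f = p \<longrightarrow> r g = p \<longrightarrow>
    corner_coeff (q p) (star (v f) * X $$ (s, t) * v g) =
    (\<Sum>u<m. \<Sum>c\<in>{c\<in>F. r c = p}. cnj (C (u, c) (s, f)) * C (u, c) (t, g))"
    by (rule ballI) (rule gram_coefficients[OF _ Y X])
  from bchoice[OF this] obtain C where "\<forall>p\<in>r ` F. \<forall>s<m. \<forall>t<m. \<forall>f\<in>F. \<forall>g\<in>F.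
      r f = p \<longrightarrow> r g = p \<longrightarrow>
    corner_coeff (q p) (star (v f) * X $$ (s, t) * v g) =
    (\<Sum>u<m. \<Sum>c\<in>{c\<in>F. r c = p}. cnj (C p (u, c) (s, f)) * C p (u, c) (t, g))"
    by (rule exE)
  then have C: "corner_coeff (q p) (star (v f) * X $$ (s, t) * v g) =
    (\<Sum>u<m. \<Sum>c\<in>{c\<in>F. r c = p}. cnj (C p (u, c) (s, f)) * C p (u, c) (t, g))"
    if "p \<in> r ` F" "s < m" "t < m" "f \<in> F" "g \<in> F" "r f = p" "r g = p" for p s t f g
    using that by blast
  \<comment> \<open>Zero across classes, so that the factors of different classes do not interact in
    products of matrix units.\<close>
  define D where "D u c t g = (if r c = r g then C (r g) (u, c) (t, g) else 0)" for u c t g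
  define Z where "Z = mat m m (\<lambda>(u, t). \<Sum>c\<in>F. \<Sum>g\<in>F. scaleC (D u c t g) (e c g))"
  have Z: "Z \<in> carrier_mat m m" by (simp add: Z_def)
  have "elements_mat Z \<subseteq> B"
    by (auto simp: elements_mat_def Z_def intro!: subalg_closed[OF S] e_in)
  moreover have "map_mat E X = map_mat star (transpose_mat Z) * Z"
  proof (rule eq_matI)
    fix s t assume "s < dim_row (map_mat star (transpose_mat Z) * Z)" "t < dim_col (map_mat star (transpose_mat Z) * Z)"
    then have st: "s < m" "t < m" by (simp_all add: Z_def)
    have "star (Z $$ (u, s)) * Z $$ (u, t) =
      (\<Sum>f\<in>F. \<Sum>g\<in>F. \<Sum>c\<in>F. scaleC (cnj (D u c s f) * D u c t g) (e f g))" if "u < m" for u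
    proof -
      have "star (Z $$ (u, s)) * Z $$ (u, t) =
        (\<Sum>c\<in>F. \<Sum>f\<in>F. scaleC (cnj (D u c s f)) (e f c)) * (\<Sum>c\<in>F. \<Sum>g\<in>F. scaleC (D u c t g) (e c g))"
        using that st by (simp add: Z_def)
      also have "\<dots> = (\<Sum>f\<in>F. \<Sum>c\<in>F. scaleC (cnj (D u c s f)) (e f c)) *
         (\<Sum>g\<in>F. \<Sum>c\<in>F. scaleC (D u c t g) (e c g))"
        by (subst sum.swap, subst (2) sum.swap) simp
      also have "\<dots> = (\<Sum>f\<in>F. \<Sum>g\<in>F. \<Sum>c\<in>F. \<Sum>c'\<in>F. scaleC (cnj (D u c s f) * D u c' t g) (e f c * e c' g))"
        by (simp add: sum_product mult.commute)
      also have "\<dots> = (\<Sum>f\<in>F. \<Sum>g\<in>F. \<Sum>c\<in>F. scaleC (cnj (D u c s f) * D u c t g) (e f g))"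
      proof (intro sum.cong refl)
        fix f g c assume *: "f \<in> F" "g \<in> F" "c \<in> F"
        have "scaleC (cnj (D u c s f) * D u c' t g) (e f c * e c' g) =
          (if c' = c then scaleC (cnj (D u c s f) * D u c t g) (e f g) else 0)" if "c' \<in> F" for c'
          using * that e_mult_e[of f c c' g] by (auto simp: D_def)
        then show "(\<Sum>c'\<in>F. scaleC (cnj (D u c s f) * D u c' t g) (e f c * e c' g)) =
          scaleC (cnj (D u c s f) * D u c t g) (e f g)"
          using * by simp
      qed
      finally show ?thesis .
    qed
    then have "(map_mat star (transpose_mat Z) * Z) $$ (s, t) =
      (\<Sum>u<m. \<Sum>f\<in>F. \<Sum>g\<in>F. \<Sum>c\<in>F. scaleC (cnj (D u c s f) * D u c t g) (e f g))"
      using star_transpose_mult_index[OF Z st] by simp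
    also have "\<dots> = (\<Sum>f\<in>F. \<Sum>g\<in>F. \<Sum>u<m. \<Sum>c\<in>F. scaleC (cnj (D u c s f) * D u c t g) (e f g))"
      by (rule sum_rotate[symmetric])
    also have "\<dots> = E (X $$ (s, t))" unfolding E_def
    proof (intro sum.cong refl)
      fix f g assume fg: "f \<in> F" "g \<in> F"
      show "(\<Sum>u<m. \<Sum>c\<in>F. scaleC (cnj (D u c s f) * D u c t g) (e f g)) =
        scaleC (corner_coeff (q (r f)) (star (v f) * X $$ (s, t) * v g)) (e f g)"
      proof (cases "r f = r g")
        case True
        have "(\<Sum>c\<in>F. cnj (D u c s f) * D u c t g) =
          (\<Sum>c\<in>{c\<in>F. r c = r f}. cnj (C (r f) (u, c) (s, f)) * C (r f) (u, c) (t, g))" for u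
          using True by (auto simp: D_def sum.inter_filter intro!: sum.cong)
        then show ?thesis
          using C[OF _ st fg refl True[symmetric]] fg
          by (simp flip: complex_space.scale_sum_left)
      qed (simp add: fg e_eq_0)
    qed
    finally show "map_mat E X $$ (s, t) = (map_mat star (transpose_mat Z) * Z) $$ (s, t)"
      using X Y st by simp
  qed (use X Y in \<open>auto simp: Z_def\<close>)
  ultimately show "mat_positive_in m B (map_mat E X)"
    using Z by (auto simp: mat_positive_in_def)
qed

lemma E_conditional_expectation: "conditional_expectation B E"
  unfolding conditional_expectation_def
proof (intro conjI ballI)
  show "Vector_Spaces.linear scaleC scaleC E"
    by unfold_locales (auto simp: E_add E_scaleC)
qed (use E_in E_identity subalg_one[OF S] E_completely_positive in auto)

end

text \<open>Makes the state at \<open>q (r f)\<close> visible in \<open>E\<close>; this separates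
  expectations built from different \<open>q\<close>.\<close>

lemma (in expectation_data) E_conj:
  assumes f: "f \<in> F" and x: "r f * x * r f = x"
  shows "E (v f * x * star (v f)) = scaleC (corner_coeff (q (r f)) x) f"
proof -
  have *: "star (v h) * (v f * x * star (v f)) * v g = (if h = f \<and> g = f then x else 0)"
    if "h \<in> F" "g \<in> F" for h g
  proof -
    have "star (v h) * (v f * x * star (v f)) * v g = (star (v h) * v f) * x * (star (v f) * v g)"
      by (simp only: mult.assoc)
    then show ?thesis using that f x by auto
  qed
  have "E (v f * x * star (v f)) =
    (\<Sum>h\<in>F. \<Sum>g\<in>F. if g = f then if h = f then scaleC (corner_coeff (q (r f)) x) f else 0 else 0)"
    unfolding E_def
    by (intro sum.cong refl) (use f minimal_projectionD(4)[OF q_min] in \<open>auto simp: *\<close>)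
  then show ?thesis using f by simp
qed

section \<open>Commutant and minimality in the ambient algebra\<close>

context matrix_units
begin

lemma e_mult_e_if:
  assumes "f \<in> F" "g \<in> F" "h \<in> F" "k \<in> F"
  shows "e f g * e h k = (if g = h \<and> r f = r g then e f k else 0)"
  by (cases "r f = r g") (use e_mult_e[OF assms] e_eq_0[OF assms(1,2)] in simp_all)

lemma commutantI:
  assumes "\<And>h k. h \<in> F \<Longrightarrow> k \<in> F \<Longrightarrow> a * e h k = e h k * a"
  shows "a \<in> relative_commutant S"
proof -
  have "a * b = b * a" if "b \<in> S" for b
  proof -
    have "a * (\<Sum>f\<in>F. \<Sum>g\<in>F. scaleC (coefficient f g b) (e f g)) =
      (\<Sum>f\<in>F. \<Sum>g\<in>F. scaleC (coefficient f g b) (e f g)) * a"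
      by (simp add: sum_distrib_left sum_distrib_right assms)
    then show ?thesis using expand[OF that] by (simp only:)
  qed
  then show ?thesis by (simp add: relative_commutant_def)
qed

lemma minimal_in_ambient:
  assumes "relative_commutant S \<subseteq> S" and f: "f \<in> F"
  shows "minimal_projection UNIV f"
proof -
  have "\<exists>c. f * y * f = scaleC c f" for y
  proof -
    \<comment> \<open>The copies of \<open>f * y * f\<close>; terms with \<open>g\<close> outside
      the class of \<open>f\<close> are zero.\<close>
    define a where "a = (\<Sum>g\<in>F. e g f * y * e f g)"
    have "a * e h k = e h k * a" if hk: "h \<in> F" "k \<in> F" for h k
    proof -
      have z: "e h f * y * e f k = 0" if "r h \<noteq> r k"
        using that hk f e_eq_0[of h f] e_eq_0[of f k] by (cases "r h = r f") auto
      \<comment> \<open>Both products of \<open>a\<close> with \<open>e h k\<close> collapse to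
        \<open>e h f * y * e f k\<close>, which is zero by \<open>z\<close> if \<open>h\<close> and
        \<open>k\<close> are inequivalent.\<close>
      have "a * e h k = (\<Sum>g\<in>F. e g f * y * (e f g * e h k))"
        by (simp add: a_def sum_distrib_right mult.assoc)
      also have "\<dots> = (\<Sum>g\<in>F. if g = h then e h f * y * e f k else 0)"
        by (intro sum.cong refl) (use hk f in \<open>auto simp: e_mult_e_if e_eq_0\<close>)
      also have "\<dots> = (\<Sum>g\<in>F. if g = k then e h f * y * e f k else 0)" using hk by simp
      also have "\<dots> = (\<Sum>g\<in>F. (e h k * e g f) * y * e f g)"
        by (intro sum.cong refl) (use hk f z in \<open>auto simp: e_mult_e_if e_eq_0\<close>)
      also have "\<dots> = e h k * a" by (simp add: a_def sum_distrib_left mult.assoc)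
      finally show ?thesis .
    qed
    then have "a \<in> S" using commutantI assms by blast
    have "f * a * f = (\<Sum>g\<in>F. (f * e g f) * y * (e f g * f))"
      by (simp add: a_def sum_distrib_left sum_distrib_right mult.assoc)
    also have "\<dots> = (\<Sum>g\<in>F. if g = f then f * y * f else 0)"
    proof (intro sum.cong refl)
      fix g assume g: "g \<in> F"
      have "f * e g f = 0" if "g \<noteq> f"
        by (rule mult_eq_0_via[OF idem e_left orthogonal]) (use f g that in auto)
      then show "(f * e g f) * y * (e f g * f) = (if g = f then f * y * f else 0)"
        using f by auto
    qed
    finally have "f * a * f = f * y * f" using f by simp
    then show ?thesis using corner_coeff[OF min[OF f] \<open>a \<in> S\<close>] by metis
  qed
  then show ?thesis using minD[OF f] by (simp add: minimal_projection_def)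
qed

text \<open>Diagonal corners of an element of the commutant are scalar by minimality, and
  off-diagonal corners vanish because it commutes with each \<open>f\<close>.\<close>

lemma commutant_subset_of_minimal:
  assumes "\<And>f. f \<in> F \<Longrightarrow> minimal_projection UNIV f"
  shows "relative_commutant S \<subseteq> S"
proof
  fix a assume a: "a \<in> relative_commutant S"
  have "f * a * g \<in> S" if fg: "f \<in> F" "g \<in> F" for f g
  proof (cases "f = g")
    case True
    have "f * a * f = scaleC (corner_coeff f a) f" using corner_coeff[OF assms[OF fg(1)]] by simp
    then show ?thesis using True subalg_scale[OF S] F_in fg by simp
  next
    case False
    have "f * a = a * f" using a F_in[OF fg(1)] by (simp add: relative_commutant_def)
    then have "f * a * g = a * (f * g)" by (simp add: mult.assoc)
    then show ?thesis using False orthogonal fg subalg_zero[OF S] by simp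
  qed
  then show "a \<in> S" by (subst decompose) (intro subalg_sum[OF S])
qed

text \<open>The states that define expectations live on representatives; conjugation by
  \<open>v f\<close> carries minimality from there to \<open>f\<close>.\<close>

lemma minimal_of_representative:
  assumes f: "f \<in> F" and rf: "minimal_projection UNIV (r f)"
  shows "minimal_projection UNIV f"
proof -
  have "f * y * f = scaleC (corner_coeff (r f) (star (v f) * y * v f)) f" for y
  proof -
    have "f * y * f = (v f * star (v f)) * y * (v f * star (v f))" using f by simp
    also have "\<dots> = (v f * r f) * (star (v f) * y * v f) * (r f * star (v f))"
      by (simp only: v_right[OF f] star_v_left[OF f] mult.assoc)
    also have "\<dots> = v f * (r f * (star (v f) * y * v f) * r f) * star (v f)" by (simp only: mult.assoc)
    finally show ?thesis unfolding corner_coeff[OF rf UNIV_I] using f by simp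
  qed
  then show ?thesis using minD[OF f] by (auto simp: minimal_projection_def)
qed

text \<open>A nonminimal representative dominates two orthogonal minimal projections
  \<open>s\<close> and \<open>t\<close> of the ambient algebra. The resulting expectations send the
  copy of \<open>s\<close> at \<open>f\<close> to \<open>f\<close> and to 0, respectively.\<close>

lemma minimal_of_unique_expectation:
  assumes fd: "finite_dimensional TYPE('a)" and unique: "\<exists>!E. conditional_expectation S E"
    and f: "f \<in> F"
  shows "minimal_projection UNIV f"
proof (rule minimal_of_representative[OF f], rule ccontr)
  define p where "p = r f"
  assume "\<not> minimal_projection UNIV (r f)"
  then have nonmin: "\<not> minimal_projection UNIV p" by (simp add: p_def)
  have p: "p \<in> F" using f by (simp add: p_def)
  note below = minimal_projection_below[OF fd unital_UNIV UNIV_I]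
  obtain s where s: "minimal_projection UNIV s" "s * p = s" "p * s = s"
    using below[of p] minD[OF p] by blast
  \<comment> \<open>If \<open>p = s\<close>, then \<open>p\<close> would be minimal; hence there is
    room for \<open>t\<close> below \<open>p - s\<close>.\<close>
  have "p - s \<noteq> 0" using s nonmin by auto
  then obtain t where t: "minimal_projection UNIV t" "t * (p - s) = t" "(p - s) * t = t"
    using below[of "p - s"] projection_diff[of p s] minD[OF p] minimal_projectionD[OF s(1)] s by blast
  have ts: "t * s = 0" "t * p = t"
  proof -
    have "t * (p - s) * s = 0" using s by (simp add: mult.assoc left_diff_distrib minimal_projectionD[OF s(1)])
    then show "t * s = 0" by (simp add: t)
    then show "t * p = t" using t(2) by (simp add: right_diff_distrib)
  qed
  have "\<forall>g\<in>F. \<exists>u. minimal_projection UNIV u \<and> u * g = u"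
    using below minD by blast
  from bchoice[OF this] obtain q where q: "\<forall>g\<in>F. minimal_projection UNIV (q g) \<and> q g * g = q g"
    by (rule exE)
  interpret E1: expectation_data S F r v "q(p := s)"
    by unfold_locales (use q s in \<open>auto\<close>)
  interpret E2: expectation_data S F r v "q(p := t)"
    by unfold_locales (use q t ts in \<open>auto\<close>)
  have "E1.E = E2.E"
    using unique E1.E_conditional_expectation E2.E_conditional_expectation by blast
  moreover have "p * s * p = s" by (simp add: s)
  then have "E1.E (v f * s * star (v f)) = scaleC (corner_coeff s s) f"
    "E2.E (v f * s * star (v f)) = scaleC (corner_coeff t s) f"
    using E1.E_conj[OF f, of s] E2.E_conj[OF f, of s] by (simp_all add: p_def)
  moreover have "corner_coeff s s = 1"
    by (rule corner_coeff_eqI) (simp_all add: minimal_projectionD[OF s(1)])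
  moreover have "corner_coeff t s = 0"
    by (rule corner_coeff_eqI) (simp_all add: minimal_projectionD[OF t(1)] ts)
  ultimately show False using f by simp
qed

text \<open>Complete positivity applied to the Gram matrix of the row \<open>(b, x)\<close>.\<close>

lemma expectation_gram:
  assumes E: "conditional_expectation S E"
  obtains a c d g where "a \<in> S" "c \<in> S" "E (star b * b) = star a * a + star c * c"
    "E (star b * x) = star a * d + star c * g" "E (star x * b) = star d * a + star g * c"
proof -
  \<comment> \<open>A zero second row completes \<open>(b, x)\<close> to a square factor. The pairs
    \<open>(a, c)\<close> and \<open>(d, g)\<close> will be the columns of the factor of the
    image.\<close>
  define Y where "Y = mat 2 2 (\<lambda>(i, j). if i = 0 then if j = 0 then b else x else (0::'a))"
  define X where "X = map_mat star (transpose_mat Y) * Y"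
  have Y: "Y \<in> carrier_mat 2 2" by (simp add: Y_def)
  have "mat_positive_in 2 UNIV X" unfolding mat_positive_in_def X_def using Y by blast
  then have "mat_positive_in 2 S (map_mat E X)"
    using E by (simp add: conditional_expectation_def completely_positive_def)
  then obtain Z where Z: "Z \<in> carrier_mat 2 2" "elements_mat Z \<subseteq> S"
    "map_mat E X = map_mat star (transpose_mat Z) * Z"
    unfolding mat_positive_in_def by blast
  have sum2: "(\<Sum>k<2. h k) = h 0 + h 1" for h :: "nat \<Rightarrow> 'a"
    by (simp add: numeral_2_eq_2)
  have EX: "E (X $$ (i, j)) = star (Z $$ (0, i)) * Z $$ (0, j) + star (Z $$ (1, i)) * Z $$ (1, j)"
    if "i < 2" "j < 2" for i j
  proof -
    have "E (X $$ (i, j)) = map_mat E X $$ (i, j)" using that Y by (simp add: X_def)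
    then show ?thesis unfolding Z(3) star_transpose_mult_index[OF Z(1) that] sum2 .
  qed
  have Xij: "X $$ (i, j) = star (Y $$ (0, i)) * Y $$ (0, j) + star (Y $$ (1, i)) * Y $$ (1, j)"
    if "i < 2" "j < 2" for i j
    unfolding X_def star_transpose_mult_index[OF Y that] sum2 ..
  have "Z $$ (i, j) \<in> S" if "i < 2" "j < 2" for i j
    using Z that by (force simp: elements_mat_def)
  then show thesis
    using EX[of 0 0] EX[of 0 1] EX[of 1 0] Xij[of 0 0] Xij[of 0 1] Xij[of 1 0]
    by (intro that[of "Z $$ (0, 0)" "Z $$ (1, 0)" "Z $$ (0, 1)" "Z $$ (1, 1)"]) (auto simp: Y_def)
qed

section \<open>Adjoints and corners under an expectation\<close>

lemma expectation_star:
  assumes E: "conditional_expectation S E" shows "E (star x) = star (E x)"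
proof -
  obtain a c d g where "E (star 1 * x) = star a * d + star c * g" "E (star x * 1) = star d * a + star g * c"
    by (rule expectation_gram[OF E])
  then show ?thesis by (simp add: star_mult)
qed

text \<open>The bimodule property for projections. From \<open>E q = q\<close> the Gram factors
  satisfy \<open>a * q = a\<close> and \<open>c * q = c\<close>, so \<open>q\<close> is a left unit
  for \<open>E (q * y)\<close>. Used for \<open>p\<close> and for \<open>1 - p\<close>, this
  isolates the two parts of \<open>E x\<close>.\<close>

lemma expectation_projection_left:
  assumes E: "conditional_expectation S E" and p: "projection p" "p \<in> S"
  shows "E (p * x) = p * E x"
proof -
  have lin: "Vector_Spaces.linear scaleC scaleC E"
    using E by (simp add: conditional_expectation_def)
  have *: "q * E (q * y) = E (q * y)" if q: "projection q" "q \<in> S" for q y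
  proof -
    have qq: "q * q = q" "star q = q" using q by (auto simp: projection_def)
    obtain a c d g where g: "a \<in> S" "c \<in> S" "E (star q * q) = star a * a + star c * c"
      "E (star q * y) = star a * d + star c * g"
      by (rule expectation_gram[OF E])
    have "star a * a + star c * c = q"
      using g(3) E q qq by (simp add: conditional_expectation_def)
    \<comment> \<open>Compression by \<open>1 - q\<close> turns the identity into a vanishing sum of
      two squares, each of which must vanish.\<close>
    then have "(1 - q) * (star a * a + star c * c) * (1 - q) = 0"
      by (simp add: algebra_simps qq)
    then have eq0: "star (a * (1 - q)) * (a * (1 - q)) + star (c * (1 - q)) * (c * (1 - q)) = 0"
      by (simp add: star_mult qq distrib_left distrib_right mult.assoc)
    have in_S: "a * (1 - q) \<in> S" "c * (1 - q) \<in> S"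
      by (intro subalg_closed[OF S] g q)+
    have "a * (1 - q) = 0" by (rule star_mult_add_eq_0D[OF in_S eq0])
    moreover have "c * (1 - q) = 0"
      by (rule star_mult_add_eq_0D[OF in_S(2,1)]) (use eq0 in \<open>simp add: add.commute\<close>)
    ultimately have "a * q = a" "c * q = c" by (simp_all add: right_diff_distrib)
    then have "q * star a = star a" "q * star c = star c" using qq by (metis star_mult)+
    then show ?thesis using g(4) qq by (simp add: distrib_left flip: mult.assoc)
  qed
  have p': "projection (1 - p)" "1 - p \<in> S" using p
    by (auto simp: projection_def algebra_simps intro!: subalg_closed[OF S])
  have pp: "p * (1 - p) = 0" using p by (simp add: projection_def algebra_simps)
  have "x = p * x + (1 - p) * x" by (simp add: algebra_simps)
  then have "E x = E (p * x) + E ((1 - p) * x)"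
    using lin by (metis Vector_Spaces.linear_iff)
  then have "p * E x = E (p * x) + p * ((1 - p) * E ((1 - p) * x))"
    using *[OF p] *[OF p'] by (simp add: distrib_left)
  then show ?thesis by (simp add: pp flip: mult.assoc)
qed

lemma expectation_corner:
  assumes E: "conditional_expectation S E" and "f \<in> F" "g \<in> F"
  shows "E (f * x * g) = f * E x * g"
proof -
  have "E (y * g) = E y * g" for y
  proof -
    have "E (star (g * star y)) = star (E (g * star y))" by (rule expectation_star[OF E])
    then show ?thesis
      using assms by (simp add: expectation_projection_left[OF E] minD star_mult expectation_star[OF E])
  qed
  then show ?thesis using assms by (simp add: expectation_projection_left[OF E] minD)
qed

text \<open>A nonzero corner is a multiple of the matrix unit \<open>e f g\<close>, which then lies
  in the ideal together with \<open>f = e f g * e g f\<close> and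
  \<open>g = e g f * e f g\<close>.\<close>

lemma ideal_corner_eq_0:
  assumes J: "closed_ideal J S" and x: "x \<in> J" and fg: "f \<in> F" "g \<in> F" and "f \<notin> J \<or> g \<notin> J"
  shows "f * x * g = 0"
proof (rule ccontr)
  assume nz: "f * x * g \<noteq> 0"
  have JD: "J \<subseteq> S" "complex_space.subspace J" "\<And>b x. b \<in> S \<Longrightarrow> x \<in> J \<Longrightarrow> b * x \<in> J"
    "\<And>b x. b \<in> S \<Longrightarrow> x \<in> J \<Longrightarrow> x * b \<in> J"
    using J by (auto simp: closed_ideal_def)
  have rr: "r f = r g" using nz inequivalent[OF fg] x JD by blast
  define c where "c = coefficient f g x"
  have c: "f * x * g = scaleC c (e f g)" unfolding c_def using x JD by (intro corner_eq fg) auto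
  have "c \<noteq> 0" using nz c by auto
  then have "e f g = scaleC (1 / c) (f * x * g)" by (simp add: c)
  moreover have "f * x * g \<in> J" using JD x fg F_in by blast
  ultimately have ej: "e f g \<in> J" using JD by (simp add: complex_space.subspace_scale)
  have "e f g * e g f \<in> J" "e g f * e f g \<in> J" using ej JD e_in fg by blast+
  then show False using assms rr fg by (simp add: e_mult_e)
qed

text \<open>The sum \<open>u\<close> of the projections of \<open>F\<close> in \<open>J\<close> is a
  unit of \<open>J\<close> and central in \<open>S\<close>. Hence \<open>\<phi> u\<close> lies in
  the relative commutant, and \<open>\<phi>\<close> is left multiplication by it.\<close>

lemma Max'_of_commutant_subset:
  assumes "relative_commutant S \<subseteq> S"
  shows "Max' S"
  unfolding Max'_def
proof (intro allI impI)
  fix J \<phi> assume vc: "virtual_commutant S J \<phi>"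
  then have J: "closed_ideal J S" by (simp add: virtual_commutant_def)
  have JD: "J \<subseteq> S" "complex_space.subspace J" "\<And>b x. b \<in> S \<Longrightarrow> x \<in> J \<Longrightarrow> b * x \<in> J"
    "\<And>b x. b \<in> S \<Longrightarrow> x \<in> J \<Longrightarrow> x * b \<in> J"
    using J by (auto simp: closed_ideal_def)
  have \<phi>: "\<phi> (b * x) = b * \<phi> x" "\<phi> (x * b) = \<phi> x * b" if "b \<in> S" "x \<in> J" for b x
    using vc that by (auto simp: virtual_commutant_def)
  define u where "u = \<Sum>(F \<inter> J)"
  have uJ: "u \<in> J" unfolding u_def using JD by (intro complex_space.subspace_sum) auto
  have unit: "u * x = x" "x * u = x" if x: "x \<in> J" for x
  proof -
    have z: "f * x * g = 0" if "f \<in> F" "g \<in> F" "f \<notin> J \<or> g \<notin> J" for f g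
      using ideal_corner_eq_0[OF J x] that by blast
    have "x = \<Sum>F * x * \<Sum>F" by simp
    also have "\<dots> = (\<Sum>f\<in>F. \<Sum>g\<in>F. f * x * g)" using decompose[of x] by simp
    also have "\<dots> = (\<Sum>f\<in>F \<inter> J. \<Sum>g\<in>F. f * x * g)"
      by (rule sum.mono_neutral_right) (auto simp: z intro!: sum.neutral)
    also have "\<dots> = (\<Sum>f\<in>F \<inter> J. f * x * \<Sum>F)" by (simp only: sum_distrib_left)
    also have "\<dots> = u * x * \<Sum>F" by (simp only: u_def sum_distrib_right)
    finally show "u * x = x" by simp
    have "x = (\<Sum>f\<in>F. \<Sum>g\<in>F. f * x * g)" by (rule decompose)
    also have "\<dots> = (\<Sum>f\<in>F. \<Sum>g\<in>F \<inter> J. f * x * g)"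
      by (intro sum.cong refl sum.mono_neutral_right) (auto simp: z)
    also have "\<dots> = (\<Sum>f\<in>F. f * x * u)" by (simp only: u_def sum_distrib_left)
    also have "\<dots> = \<Sum>F * x * u" by (simp only: sum_distrib_right)
    finally show "x * u = x" by simp
  qed
  \<comment> \<open>Both \<open>u * b\<close> and \<open>b * u\<close> lie in \<open>J\<close>, so
    each equals \<open>u * b * u\<close>.\<close>
  have "u * b = b * u" if b: "b \<in> S" for b
    using unit(2)[of "u * b"] unit(1)[of "b * u"] JD b uJ by (simp add: mult.assoc)
  then have "\<phi> u * b = b * \<phi> u" if "b \<in> S" for b
    using \<phi>[OF that uJ] that by metis
  then have "\<phi> u \<in> relative_commutant S" by (simp add: relative_commutant_def)
  then have "\<phi> u \<in> S" using assms by blast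
  moreover have "\<phi> x = \<phi> u * x" if "x \<in> J" for x
    using \<phi>(2)[OF _ uJ, of x] unit(1)[OF that] JD that by auto
  ultimately show "\<phi> ` J \<subseteq> S" using JD by (auto intro!: subalg_mult[OF S])
qed

end

text \<open>Left multiplication by \<open>a\<close> is a virtual commutant on the ideal
  \<open>B\<close> itself, and its value at 1 is \<open>a\<close>.\<close>

lemma commutant_subset_of_Max':
  assumes B: "unital_cstar_subalgebra B" and "Max' B"
  shows "relative_commutant B \<subseteq> B"
proof
  fix a assume a: "a \<in> relative_commutant B"
  have "a * (b * x) = b * (a * x)" if "b \<in> B" for b x
    using a that by (simp add: relative_commutant_def flip: mult.assoc)
  then have "virtual_commutant B B (\<lambda>x. a * x)"
    using B
    unfolding virtual_commutant_def closed_ideal_def unital_cstar_subalgebra_def cstar_subalgebra_def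
    by (simp add: distrib_left mult.assoc)
  then have "a * 1 \<in> B" using assms subalg_one[OF B] unfolding Max'_def by blast
  then show "a \<in> B" by simp
qed

section \<open>Subalgebras whose minimal projections stay minimal\<close>

locale ambient_minimal_units = matrix_units B F r v for B F :: "'a::cstar_algebra set" and r v +
  assumes ambient_min: "f \<in> F \<Longrightarrow> minimal_projection UNIV f"
begin

lemma corner_in: "f \<in> F \<Longrightarrow> f * x * f \<in> B"
  using corner_coeff[OF ambient_min, of f x] subalg_scale[OF S F_in] by simp

text \<open>Multiplication by \<open>e g f\<close> moves the corner onto the diagonal, where it is
  scalar, and \<open>e f g\<close> moves it back.\<close>

lemma class_corner_in:
  assumes "f \<in> F" "g \<in> F" "r f = r g" shows "f * x * g \<in> B"
proof -
  have "f * x * g = f * (x * e g f) * f * e f g"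
    using assms e_mult_e[of g f f g] by (simp add: mult.assoc)
  then show ?thesis using subalg_mult[OF S corner_in e_in] assms by metis
qed

text \<open>Conjugation by \<open>f * x * g\<close> and by its adjoint ends in a diagonal corner,
  which is contained in \<open>B\<close>; these normalizers add up to \<open>x\<close>.\<close>

lemma regular: "regular B"
proof -
  have norm: "f * x * g \<in> normalizer B" if fg: "f \<in> F" "g \<in> F" for f g x
  proof -
    have "f * x * g * b * star (f * x * g) = f * (x * g * b * g * star x) * f"
      "star (f * x * g) * b * (f * x * g) = g * (star x * f * b * f * x) * g" for b
      using fg by (simp_all add: star_mult mult.assoc)
    then show ?thesis unfolding normalizer_def using corner_in fg by simp
  qed
  have "x \<in> cstar_subalgebra hull normalizer B" for x
    unfolding hull_def
  proof (intro InterI)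
    fix T assume "T \<in> {T. cstar_subalgebra T \<and> normalizer B \<subseteq> T}"
    then have T: "complex_space.subspace T" "normalizer B \<subseteq> T" by (auto simp: cstar_subalgebra_def)
    show "x \<in> T"
      by (subst decompose) (use T norm in \<open>blast intro: complex_space.subspace_sum\<close>)
  qed
  then show ?thesis by (auto simp: regular_def)
qed

lemma expectation_unique:
  assumes "conditional_expectation B E" "conditional_expectation B E'"
  shows "E = E'"
proof
  fix x
  have "f * E x * g = f * E' x * g" if fg: "f \<in> F" "g \<in> F" for f g
  proof (cases "r f = r g")
    case True
    then have "E (f * x * g) = E' (f * x * g)"
      using class_corner_in fg assms by (simp add: conditional_expectation_def)
    then show ?thesis using expectation_corner fg assms by simp
  next
    case False
    then have "f * y * g = 0" if "y \<in> B" for y using that inequivalent fg by blast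
    moreover have "E x \<in> B" "E' x \<in> B" using assms by (auto simp: conditional_expectation_def)
    ultimately show ?thesis by simp
  qed
  then show "E x = E' x" using decompose[of "E x"] decompose[of "E' x"] by simp
qed

text \<open>Positivity is the case of 1 by 1 matrices. If \<open>E (star x * x)\<close> vanishes, so
  does its corner at \<open>f\<close>; this is \<open>f * (star x * x) * f\<close>, which lies in
  \<open>B\<close> and is fixed by \<open>E\<close>.\<close>

lemma expectation_faithful:
  assumes E: "conditional_expectation B E" shows "faithful B E"
  unfolding faithful_def
proof (intro allI impI conjI)
  fix x :: 'a assume "x \<noteq> 0"
  define Y where "Y = mat 1 1 (\<lambda>_. x)"
  have Y: "Y \<in> carrier_mat 1 1" by (simp add: Y_def)
  have "mat_positive_in 1 UNIV (map_mat star (transpose_mat Y) * Y)"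
    unfolding mat_positive_in_def using Y by blast
  then have "mat_positive_in 1 B (map_mat E (map_mat star (transpose_mat Y) * Y))"
    using E by (simp add: conditional_expectation_def completely_positive_def)
  then obtain Z where Z: "Z \<in> carrier_mat 1 1" "elements_mat Z \<subseteq> B"
    "map_mat E (map_mat star (transpose_mat Y) * Y) = map_mat star (transpose_mat Z) * Z"
    unfolding mat_positive_in_def by blast
  have "E ((map_mat star (transpose_mat Y) * Y) $$ (0, 0)) = (map_mat star (transpose_mat Z) * Z) $$ (0, 0)"
    using Y by (simp flip: Z(3))
  then have "E (star x * x) = star (Z $$ (0, 0)) * Z $$ (0, 0)"
    using star_transpose_mult_index[OF Z(1), of 0 0] star_transpose_mult_index[OF Y, of 0 0]
    by (simp add: Y_def)
  moreover have "Z $$ (0, 0) \<in> B" using Z by (force simp: elements_mat_def)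
  ultimately show "positive_in B (E (star x * x))" by (auto simp: positive_in_def)
  show "E (star x * x) \<noteq> 0"
  proof
    assume E0: "E (star x * x) = 0"
    have "x * f = 0 * f" if f: "f \<in> F" for f
    proof -
      have "f * (star x * x) * f = E (f * (star x * x) * f)"
        using corner_in[OF f] E by (simp add: conditional_expectation_def)
      also have "\<dots> = 0" using expectation_corner[OF E f f] E0 by simp
      finally have "star (x * f) * (x * f) = 0" using f by (simp add: star_mult mult.assoc)
      then show ?thesis by simp
    qed
    then have "x = 0" by (rule eqI_right)
    then show False using \<open>x \<noteq> 0\<close> by simp
  qed
qed

lemma expectation_exists: "\<exists>E. conditional_expectation B E"
proof -
  \<comment> \<open>Each \<open>f\<close> is minimal in the ambient algebra, so the representatives
    themselves are a valid choice.\<close>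
  interpret expectation_data B F r v "\<lambda>p. p"
    by unfold_locales (auto simp: ambient_min)
  show ?thesis using E_conditional_expectation by blast
qed

end

lemma contains_approximate_unit_unital:
  assumes "unital_cstar_subalgebra B" shows "contains_approximate_unit B"
proof -
  have "positive_in UNIV (1::'a)" unfolding positive_in_def by (intro bexI[of _ 1]) auto
  then show ?thesis unfolding contains_approximate_unit_def
    using subalg_one[OF assms]
    by (intro exI[of _ "principal {1}"])
      (auto simp: eventually_principal principal_eq_bot_iff intro!: tendsto_eventually)
qed

section \<open>Multiplicity free subalgebras\<close>

text \<open>The matrix positions of a block diagonal matrix with blocks \<open>js\<close>, labelled by block and
  position inside the block.\<close>

definition positions :: "(nat \<Rightarrow> nat) \<Rightarrow> nat list \<Rightarrow> (nat \<times> nat) list" where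
  "positions d js = concat (map (\<lambda>j. map (Pair j) [0..<d j]) js)"

text \<open>For entries at most 1 this list replaces the repetitions in \<open>Phi\<close>: block
  \<open>j\<close> occurs once or not at all.\<close>

definition row_blocks :: "nat mat \<Rightarrow> nat \<Rightarrow> nat list" where
  "row_blocks \<Lambda> i = filter (\<lambda>j. \<Lambda> $$ (i, j) = 1) [0..<dim_col \<Lambda>]"

lemma set_positions: "set (positions d js) = {(j, a). j \<in> set js \<and> a < d j}"
  by (auto simp: positions_def)

lemma distinct_positions: "distinct js \<Longrightarrow> distinct (positions d js)"
proof (induction js)
  case (Cons j js)
  have "positions d (j # js) = map (Pair j) [0..<d j] @ positions d js" by (simp add: positions_def)
  then show ?case using Cons by (auto simp: set_positions distinct_map inj_on_def)
qed (simp add: positions_def)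

lemma length_positions: "length (positions d js) = (\<Sum>j\<leftarrow>js. d j)"
  by (simp add: positions_def length_concat comp_def)

text \<open>Since the labels are distinct, equality of labels tells whether two positions lie in the
  same block.\<close>

lemma diag_block_mat_positions:
  fixes x :: "nat \<Rightarrow> complex mat"
  assumes "distinct js" "\<And>j. j \<in> set js \<Longrightarrow> x j \<in> carrier_mat (d j) (d j)"
  defines "P \<equiv> positions d js"
  shows "diag_block_mat (map x js) \<in> carrier_mat (length P) (length P) \<and>
    (\<forall>s<length P. \<forall>t<length P. diag_block_mat (map x js) $$ (s, t) =
       (if fst (P ! s) = fst (P ! t) then x (fst (P ! s)) $$ (snd (P ! s), snd (P ! t)) else 0))"
  using assms(1,2) unfolding P_def
proof (induction js)
  case Nil
  then show ?case by (simp add: positions_def)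
next
  case (Cons j js)
  define P where "P = positions d js"
  have P: "positions d (j # js) = map (Pair j) [0..<d j] @ P" by (simp add: positions_def P_def)
  define D where "D = diag_block_mat (map x js)"
  have IH: "D \<in> carrier_mat (length P) (length P)"
    "\<And>s t. s < length P \<Longrightarrow> t < length P \<Longrightarrow> D $$ (s, t) =
       (if fst (P ! s) = fst (P ! t) then x (fst (P ! s)) $$ (snd (P ! s), snd (P ! t)) else 0)"
    using Cons unfolding D_def P_def by auto
  have xj: "x j \<in> carrier_mat (d j) (d j)" using Cons by simp
  have eq: "diag_block_mat (map x (j # js)) = four_block_mat (x j) (0\<^sub>m (d j) (length P)) (0\<^sub>m (length P) (d j)) D"
    using xj IH(1) by (auto simp: D_def Let_def)
  have ne: "fst (P ! s) \<noteq> j" if "s < length P" for s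
    using nth_mem[OF that] Cons.prems(1) by (auto simp: P_def set_positions)
  have "diag_block_mat (map x (j # js)) $$ (s, t) =
       (if fst (positions d (j # js) ! s) = fst (positions d (j # js) ! t)
        then x (fst (positions d (j # js) ! s)) $$ (snd (positions d (j # js) ! s), snd (positions d (j # js) ! t)) else 0)"
    if st: "s < d j + length P" "t < d j + length P" for s t
  proof -
    have ne': "\<not> s < d j \<Longrightarrow> fst (P ! (s - d j)) \<noteq> j" "\<not> t < d j \<Longrightarrow> fst (P ! (t - d j)) \<noteq> j"
      using ne[of "s - d j"] ne[of "t - d j"] st by linarith+
    have "s - d j < length P" if "\<not> s < d j" using st that by linarith
    moreover have "t - d j < length P" if "\<not> t < d j" using st that by linarith
    ultimately show ?thesis
      unfolding eq P using st xj IH(1) IH(2)[of "s - d j" "t - d j"] ne'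
      by (cases "s < d j"; cases "t < d j") (auto simp: nth_append)
  qed
  then show ?case using xj IH(1) unfolding P eq by auto
qed

lemma concat_replicate_01:
  "(\<And>j. j \<in> set js \<Longrightarrow> L j \<le> (1::nat)) \<Longrightarrow>
    concat (map (\<lambda>j. replicate (L j) (x j)) js) = map x (filter (\<lambda>j. L j = 1) js)"
proof (induction js)
  case (Cons j js)
  then have "L j = 0 \<or> L j = 1" by (metis le_neq_implies_less less_one list.set_intros(1))
  then show ?case using Cons by auto
qed simp

lemma sum_list_filter_01:
  "(\<And>j. j \<in> set js \<Longrightarrow> L j \<le> (1::nat)) \<Longrightarrow>
    (\<Sum>j\<leftarrow>filter (\<lambda>j. L j = 1) js. d j) = (\<Sum>j\<leftarrow>js. L j * d j)"
proof (induction js)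
  case (Cons j js)
  then have "L j = 0 \<or> L j = 1" by (metis le_neq_implies_less less_one list.set_intros(1))
  then show ?case using Cons by auto
qed simp

lemma length_row_positions:
  assumes "\<And>j. j < dim_col \<Lambda> \<Longrightarrow> \<Lambda> $$ (i, j) \<le> 1"
  shows "length (positions d (row_blocks \<Lambda> i)) = (\<Sum>j<dim_col \<Lambda>. \<Lambda> $$ (i, j) * d j)"
  unfolding length_positions row_blocks_def
  using assms by (subst sum_list_filter_01) (auto simp: interv_sum_list_conv_sum_set_nat atLeast0LessThan)

section \<open>The image of a multiplicity free inclusion\<close>

context
  fixes ns ds :: "nat list" and \<Lambda> :: "nat mat"
  assumes inc: "inclusion_matrix ns ds \<Lambda>" and mf: "multiplicity_free_matrix \<Lambda>"
begin

definition "block_positions i = positions ((!) ds) (row_blocks \<Lambda> i)"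

lemma inclusion_matrix_dims: "dim_row \<Lambda> = length ns" "dim_col \<Lambda> = length ds"
  using inc by (auto simp: inclusion_matrix_def)

lemma entry_le_1: "i < length ns \<Longrightarrow> j < length ds \<Longrightarrow> \<Lambda> $$ (i, j) \<le> 1"
proof -
  assume ij: "i < length ns" "j < length ds"
  have "\<Lambda> $$ (i, j) \<le> (\<Sum>i<dim_row \<Lambda>. \<Lambda> $$ (i, j))"
    using ij by (intro member_le_sum) (auto simp: inclusion_matrix_dims)
  also have "\<dots> \<le> 1" using mf ij by (auto simp: multiplicity_free_matrix_def inclusion_matrix_dims)
  finally show ?thesis .
qed

text \<open>No block occurs in two summands, so the blocks of an element of the image can be
  prescribed independently.\<close>

lemma block_row_unique:
  assumes "i < length ns" "i' < length ns" "j < length ds" "\<Lambda> $$ (i, j) = 1" "\<Lambda> $$ (i', j) = 1"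
  shows "i = i'"
proof (rule ccontr)
  assume "i \<noteq> i'"
  then have "(\<Sum>i\<in>{i, i'}. \<Lambda> $$ (i, j)) = 2" using assms by simp
  moreover have "(\<Sum>i\<in>{i, i'}. \<Lambda> $$ (i, j)) \<le> (\<Sum>i<dim_row \<Lambda>. \<Lambda> $$ (i, j))"
    using assms by (intro sum_mono2) (auto simp: inclusion_matrix_dims)
  moreover have "\<dots> \<le> 1" using mf assms by (auto simp: multiplicity_free_matrix_def inclusion_matrix_dims)
  ultimately show False by simp
qed

lemma length_block_positions:
  assumes "i < length ns" shows "length (block_positions i) = ns ! i"
proof -
  have "length (block_positions i) = (\<Sum>j<length ds. \<Lambda> $$ (i, j) * ds ! j)"
    unfolding block_positions_def using entry_le_1[OF assms]
    by (subst length_row_positions) (auto simp: inclusion_matrix_dims)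
  also have "\<dots> = (\<Lambda> *\<^sub>v vec_of_list ds) $ i"
    using assms by (auto simp: scalar_prod_def inclusion_matrix_dims vec_of_list_index atLeast0LessThan)
  also have "\<dots> = ns ! i" using inc by (simp add: inclusion_matrix_def vec_of_list_index)
  finally show ?thesis .
qed

lemma distinct_block_positions: "distinct (block_positions i)"
  unfolding block_positions_def row_blocks_def by (intro distinct_positions) simp

lemma block_positions_mem:
  assumes "i < length ns" "s < ns ! i"
  shows "fst (block_positions i ! s) < length ds" "\<Lambda> $$ (i, fst (block_positions i ! s)) = 1"
    "snd (block_positions i ! s) < ds ! fst (block_positions i ! s)"
  using nth_mem[of s "block_positions i"] assms length_block_positions[OF assms(1)]
  by (auto simp: block_positions_def set_positions row_blocks_def inclusion_matrix_dims)

lemma Phi_nth: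
  assumes xs: "xs \<in> matrix_sum ds" and i: "i < length ns"
  shows "Phi \<Lambda> xs ! i \<in> carrier_mat (ns ! i) (ns ! i)"
    "s < ns ! i \<Longrightarrow> t < ns ! i \<Longrightarrow> Phi \<Lambda> xs ! i $$ (s, t) =
      (if fst (block_positions i ! s) = fst (block_positions i ! t)
       then xs ! fst (block_positions i ! s) $$ (snd (block_positions i ! s), snd (block_positions i ! t)) else 0)"
proof -
  have "Phi \<Lambda> xs ! i = diag_block_mat (map ((!) xs) (row_blocks \<Lambda> i))"
    using entry_le_1[OF i] i unfolding Phi_def row_blocks_def
    by (simp add: inclusion_matrix_dims) (subst concat_replicate_01, auto)
  moreover have "distinct (row_blocks \<Lambda> i)" by (simp add: row_blocks_def)
  moreover have "xs ! j \<in> carrier_mat (ds ! j) (ds ! j)" if "j \<in> set (row_blocks \<Lambda> i)" for j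
    using that xs by (auto simp: row_blocks_def inclusion_matrix_dims matrix_sum_def)
  ultimately show "Phi \<Lambda> xs ! i \<in> carrier_mat (ns ! i) (ns ! i)"
    "s < ns ! i \<Longrightarrow> t < ns ! i \<Longrightarrow> Phi \<Lambda> xs ! i $$ (s, t) =
      (if fst (block_positions i ! s) = fst (block_positions i ! t)
       then xs ! fst (block_positions i ! s) $$ (snd (block_positions i ! s), snd (block_positions i ! t)) else 0)"
    using diag_block_mat_positions[of "row_blocks \<Lambda> i" "(!) xs" "(!) ds"] length_block_positions[OF i]
    unfolding block_positions_def by auto
qed

lemma Phi_image:
  "Phi \<Lambda> ` matrix_sum ds = {Ms \<in> matrix_sum ns. \<forall>i<length ns. \<forall>s<ns ! i. \<forall>t<ns ! i.
     fst (block_positions i ! s) \<noteq> fst (block_positions i ! t) \<longrightarrow> Ms ! i $$ (s, t) = 0}"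
proof (intro equalityI subsetI)
  fix Ms assume "Ms \<in> Phi \<Lambda> ` matrix_sum ds"
  then obtain xs where xs: "xs \<in> matrix_sum ds" "Ms = Phi \<Lambda> xs" by blast
  have "length Ms = length ns" by (simp add: xs Phi_def inclusion_matrix_dims)
  then show "Ms \<in> {Ms \<in> matrix_sum ns. \<forall>i<length ns. \<forall>s<ns ! i. \<forall>t<ns ! i.
     fst (block_positions i ! s) \<noteq> fst (block_positions i ! t) \<longrightarrow> Ms ! i $$ (s, t) = 0}"
    using Phi_nth[OF xs(1)] by (auto simp: matrix_sum_def xs(2))
next
  fix Ms assume "Ms \<in> {Ms \<in> matrix_sum ns. \<forall>i<length ns. \<forall>s<ns ! i. \<forall>t<ns ! i.
     fst (block_positions i ! s) \<noteq> fst (block_positions i ! t) \<longrightarrow> Ms ! i $$ (s, t) = 0}"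
  then have Ms: "length Ms = length ns" "\<And>i. i < length ns \<Longrightarrow> Ms ! i \<in> carrier_mat (ns ! i) (ns ! i)"
    "\<And>i s t. i < length ns \<Longrightarrow> s < ns ! i \<Longrightarrow> t < ns ! i \<Longrightarrow>
      fst (block_positions i ! s) \<noteq> fst (block_positions i ! t) \<Longrightarrow> Ms ! i $$ (s, t) = 0"
    by (auto simp: matrix_sum_def)
  \<comment> \<open>The summand that contains block \<open>j\<close>; the next definition inverts
    the list of positions. Together they say where to read off the blocks of a preimage.\<close>
  define blk where "blk j = (THE i. i < length ns \<and> \<Lambda> $$ (i, j) = 1)" for j
  define idx where "idx i pr = (THE s. s < length (block_positions i) \<and> block_positions i ! s = pr)" for i pr
  have blk: "blk j = i" if "i < length ns" "j < length ds" "\<Lambda> $$ (i, j) = 1" for i j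
    unfolding blk_def using that block_row_unique by (intro the_equality) auto
  have idx: "idx i (block_positions i ! s) = s" if "i < length ns" "s < ns ! i" for i s
    unfolding idx_def using that distinct_block_positions[of i] length_block_positions[of i]
    by (intro the_equality) (auto simp: nth_eq_iff_index_eq)
  define xs where "xs = map (\<lambda>j. mat (ds ! j) (ds ! j)
    (\<lambda>(a, b). Ms ! blk j $$ (idx (blk j) (j, a), idx (blk j) (j, b)))) [0..<length ds]"
  have xs: "xs \<in> matrix_sum ds" by (auto simp: xs_def matrix_sum_def)
  have "Phi \<Lambda> xs = Ms"
  proof (rule nth_equalityI)
    show "length (Phi \<Lambda> xs) = length Ms" by (simp add: Phi_def inclusion_matrix_dims Ms)
    fix i assume "i < length (Phi \<Lambda> xs)"
    then have i: "i < length ns" by (simp add: Phi_def inclusion_matrix_dims)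
    show "Phi \<Lambda> xs ! i = Ms ! i"
    proof (rule eq_matI)
      fix s t assume "s < dim_row (Ms ! i)" "t < dim_col (Ms ! i)"
      then have st: "s < ns ! i" "t < ns ! i" using Ms(2)[OF i] by auto
      show "Phi \<Lambda> xs ! i $$ (s, t) = Ms ! i $$ (s, t)"
      proof (cases "fst (block_positions i ! s) = fst (block_positions i ! t)")
        case True
        define j where "j = fst (block_positions i ! s)"
        have j: "j < length ds" "\<Lambda> $$ (i, j) = 1" "snd (block_positions i ! s) < ds ! j"
          "snd (block_positions i ! t) < ds ! j"
          using block_positions_mem[OF i st(1)] block_positions_mem[OF i st(2)] True by (auto simp: j_def)
        have "(j, snd (block_positions i ! s)) = block_positions i ! s"
          "(j, snd (block_positions i ! t)) = block_positions i ! t" using True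
          by (simp_all add: j_def prod_eq_iff)
        then show ?thesis
          using Phi_nth(2)[OF xs i st] True j blk[OF i j(1,2)] idx[OF i st(1)] idx[OF i st(2)]
          by (simp add: xs_def j_def[symmetric])
      next
        case False
        then show ?thesis using Phi_nth(2)[OF xs i st] Ms(3)[OF i st] by simp
      qed
    qed (use Phi_nth(1)[OF xs i] Ms(2)[OF i] in auto)
  qed
  then show "Ms \<in> Phi \<Lambda> ` matrix_sum ds" using xs by blast
qed

end

section \<open>Unitary conjugation and block indicators\<close>

lemma mat_adjoint_carrier [simp]: "A \<in> carrier_mat n n \<Longrightarrow> mat_adjoint A \<in> carrier_mat n n"
  by (auto simp: mat_adjoint_def mat_of_rows_def)

lemma mat_adjoint_index:
  assumes "A \<in> carrier_mat n n" "s < n" "t < n"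
  shows "mat_adjoint A $$ (s, t) = cnj (A $$ (t, s))"
  using assms by (auto simp: mat_adjoint_def mat_of_rows_def)

lemma mult_mat_index:
  fixes A :: "'b::semiring_0 mat"
  assumes "A \<in> carrier_mat n n" "D \<in> carrier_mat n n" "s < n" "t < n"
  shows "(A * D) $$ (s, t) = (\<Sum>k<n. A $$ (s, k) * D $$ (k, t))"
  using assms by (simp add: scalar_prod_def atLeast0LessThan)

lemma unitary_conj_mult:
  fixes u :: "complex mat"
  assumes "u \<in> carrier_mat n n" "w \<in> carrier_mat n n" "x \<in> carrier_mat n n" "y \<in> carrier_mat n n"
    and "w * u = 1\<^sub>m n"
  shows "(u * x * w) * (u * y * w) = u * (x * y) * w"
proof -
  have "(u * x * w) * (u * y * w) = u * x * ((w * u) * (y * w))"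
    using assms(1-4) by (simp add: assoc_mult_mat[of _ n n _ n _ n])
  also have "\<dots> = u * (x * y) * w"
    unfolding assms(5) using assms(1-4) by (simp add: assoc_mult_mat[of _ n n _ n _ n])
  finally show ?thesis .
qed

lemma unitary_conj_inject:
  fixes u :: "complex mat"
  assumes "u \<in> carrier_mat n n" "w \<in> carrier_mat n n" "x \<in> carrier_mat n n" "y \<in> carrier_mat n n"
    and "w * u = 1\<^sub>m n" "u * x * w = u * y * w"
  shows "x = y"
proof -
  have *: "w * (u * z * w) * u = z" if z: "z \<in> carrier_mat n n" for z
  proof -
    have "w * (u * z * w) * u = (w * u) * z * (w * u)"
      using assms(1,2) z by (simp add: assoc_mult_mat[of _ n n _ n _ n])
    then show ?thesis using z assms(5) by simp
  qed
  have "x = w * (u * x * w) * u" by (rule *[OF assms(3), symmetric])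
  also have "\<dots> = y" unfolding assms(6) by (rule *[OF assms(4)])
  finally show ?thesis .
qed

text \<open>The image of \<open>B\<close> contains the indicator of each block. What commutes with
  all indicators is block diagonal, hence in that image, and the identification is
  injective.\<close>

lemma commutant_subset_of_multiplicity_free:
  assumes "multiplicity_free (B :: 'a::cstar_algebra set)"
  shows "relative_commutant B \<subseteq> B"
proof
  fix a assume a: "a \<in> relative_commutant B"
  obtain ns and \<theta> :: "'a \<Rightarrow> complex mat list" and us ds \<Lambda> where iso: "star_isomorphism ns \<theta>"
    and us: "unitary_in ns us" and inc: "inclusion_matrix ns ds \<Lambda>" and mf: "multiplicity_free_matrix \<Lambda>"
    and img: "(\<lambda>b. map2 (\<lambda>u x. u * x * mat_adjoint u) us (\<theta> b)) ` B = Phi \<Lambda> ` matrix_sum ds"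
    using assms unfolding multiplicity_free_def by blast
  define C where "C b = map2 (\<lambda>u x. u * x * mat_adjoint u) us (\<theta> b)" for b
  have \<theta>_in: "\<theta> x \<in> matrix_sum ns" for x
    using iso by (auto simp: star_isomorphism_def bij_betw_def)
  then have \<theta>: "length (\<theta> x) = length ns" "i < length ns \<Longrightarrow> \<theta> x ! i \<in> carrier_mat (ns ! i) (ns ! i)" for x i
    by (auto simp: matrix_sum_def)
  have u: "length us = length ns" "i < length ns \<Longrightarrow> us ! i \<in> carrier_mat (ns ! i) (ns ! i)"
    "i < length ns \<Longrightarrow> mat_adjoint (us ! i) * us ! i = 1\<^sub>m (ns ! i)" for i
    using us by (auto simp: unitary_in_def matrix_sum_def)
  have Ci: "C x ! i = us ! i * \<theta> x ! i * mat_adjoint (us ! i)" if "i < length ns" for x i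
    using that by (simp add: C_def u \<theta>)
  have C_in: "C x ! i \<in> carrier_mat (ns ! i) (ns ! i)" if "i < length ns" for x i
    unfolding Ci[OF that] using u(2) \<theta>(2) that mat_adjoint_carrier[OF u(2)] by (meson mult_carrier_mat)
  have C_mult: "C (x * y) ! i = C x ! i * C y ! i" if i: "i < length ns" for x y i
  proof -
    have "\<theta> (x * y) ! i = \<theta> x ! i * \<theta> y ! i" using iso i by (simp add: star_isomorphism_def \<theta>)
    then show ?thesis
      using unitary_conj_mult[OF u(2) mat_adjoint_carrier[OF u(2)] \<theta>(2) \<theta>(2) u(3)] i by (simp add: Ci)
  qed
  have C_inj: "x = y" if "C x = C y" for x y
  proof -
    have "\<theta> x = \<theta> y"
    proof (rule nth_equalityI)
      fix i assume "i < length (\<theta> x)"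
      then have i: "i < length ns" by (simp add: \<theta>)
      then show "\<theta> x ! i = \<theta> y ! i"
        using unitary_conj_inject[OF u(2) mat_adjoint_carrier[OF u(2)] \<theta>(2) \<theta>(2) u(3)] that Ci[OF i] by metis
    qed (simp add: \<theta>)
    then show ?thesis using iso by (auto simp: star_isomorphism_def bij_betw_def inj_on_def)
  qed
  let ?P = "block_positions ds \<Lambda>"
  note image = Phi_image[OF inc mf]
  have "C a \<in> Phi \<Lambda> ` matrix_sum ds"
    unfolding image
  proof (intro CollectI conjI allI impI)
    show "C a \<in> matrix_sum ns" using C_in by (auto simp: matrix_sum_def C_def u \<theta>)
    fix i s t assume i: "i < length ns" and st: "s < ns ! i" "t < ns ! i"
      and ne: "fst (?P i ! s) \<noteq> fst (?P i ! t)"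
    define j where "j = fst (?P i ! s)"
    \<comment> \<open>The diagonal indicator of the block of \<open>s\<close>. At
      \<open>(s, t)\<close>, multiplying by it on the right gives 0, as \<open>t\<close> lies in
      another block, while multiplying on the left keeps the entry.\<close>
    define Ms where "Ms = map (\<lambda>i. mat (ns ! i) (ns ! i)
      (\<lambda>(s, t). if s = t \<and> fst (?P i ! s) = j then 1 else 0 :: complex)) [0..<length ns]"
    have "Ms \<in> Phi \<Lambda> ` matrix_sum ds" unfolding image by (auto simp: Ms_def matrix_sum_def)
    then obtain b where b: "b \<in> B" "C b = Ms" using img unfolding C_def by (metis (no_types, lifting) imageE)
    have "a * b = b * a" using a b by (simp add: relative_commutant_def)
    then have "C a ! i * C b ! i = C b ! i * C a ! i" using C_mult[OF i] by metis
    then have eq: "(C a ! i * Ms ! i) $$ (s, t) = (Ms ! i * C a ! i) $$ (s, t)" using b by simp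
    have Ms_in: "Ms ! i \<in> carrier_mat (ns ! i) (ns ! i)" using i by (simp add: Ms_def)
    have "(C a ! i * Ms ! i) $$ (s, t) = (\<Sum>k<ns ! i. if k = t then C a ! i $$ (s, t) * Ms ! i $$ (t, t) else 0)"
      unfolding mult_mat_index[OF C_in[OF i] Ms_in st]
      by (rule sum.cong) (use st i in \<open>auto simp: Ms_def\<close>)
    also have "\<dots> = 0" using st i ne by (simp add: Ms_def j_def)
    finally have "0 = (Ms ! i * C a ! i) $$ (s, t)" using eq by simp
    also have "\<dots> = (\<Sum>k<ns ! i. if k = s then Ms ! i $$ (s, s) * C a ! i $$ (s, t) else 0)"
      unfolding mult_mat_index[OF Ms_in C_in[OF i] st]
      by (rule sum.cong) (use st i in \<open>auto simp: Ms_def\<close>)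
    also have "\<dots> = C a ! i $$ (s, t)" using st i by (simp add: Ms_def j_def)
    finally show "C a ! i $$ (s, t) = 0" by simp
  qed
  then obtain b where "b \<in> B" "C b = C a" using img unfolding C_def by (metis (no_types, lifting) imageE)
  then show "a \<in> B" using C_inj by metis
qed

section \<open>Elements as coefficient matrices\<close>

context matrix_units
begin

text \<open>The nonzero element \<open>v f\<close> connects \<open>f\<close> with
  \<open>r f\<close>, so both belong to the same class.\<close>

lemma r_idem [simp]: "f \<in> F \<Longrightarrow> r (r f) = r f"
proof (rule ccontr)
  assume f: "f \<in> F" and "r (r f) \<noteq> r f"
  then have "f * v f * r f = 0" using inequivalent[OF f r_in[OF f] _ v_in[OF f]] by auto
  then show False using f by simp
qed

lemma coefficient_add:
  assumes "f \<in> F" "x \<in> S" "y \<in> S" "g \<in> F"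
  shows "coefficient f g (x + y) = coefficient f g x + coefficient f g y"
proof -
  have "star (v f) * x * v g \<in> S" "star (v f) * y * v g \<in> S"
    by (intro subalg_closed[OF S] v_in assms)+
  then show ?thesis
    using corner_coeff_add[OF min[OF r_in[OF assms(1)]]] by (simp add: coefficient_def distrib_left distrib_right)
qed

lemma coefficient_scaleC:
  assumes "f \<in> F" "x \<in> S" "g \<in> F"
  shows "coefficient f g (scaleC c x) = c * coefficient f g x"
proof -
  have "star (v f) * x * v g \<in> S" by (intro subalg_closed[OF S] v_in assms)
  then show ?thesis
    using corner_coeff_scaleC[OF min[OF r_in[OF assms(1)]]] by (simp add: coefficient_def)
qed

lemma coefficient_star:
  assumes "f \<in> F" "x \<in> S" "g \<in> F" "r f = r g"
  shows "coefficient g f (star x) = cnj (coefficient f g x)"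
proof -
  have "star (v f) * x * v g \<in> S" by (intro subalg_closed[OF S] v_in assms)
  from corner_coeff_star[OF min[OF r_in[OF assms(1)]] this] show ?thesis
    using assms by (simp add: coefficient_def star_mult mult.assoc)
qed

lemma coefficient_mult:
  assumes fg: "f \<in> F" "g \<in> F" "r f = r g" and xy: "x \<in> S" "y \<in> S"
  shows "coefficient f g (x * y) = (\<Sum>h\<in>{h\<in>F. r h = r f}. coefficient f h x * coefficient h g y)"
proof (rule coefficient_eqI[OF fg])
  show "x * y \<in> S" by (intro subalg_closed[OF S] xy)
  have "f * (x * y) * g = f * x * \<Sum>F * (y * g)" by (simp add: mult.assoc)
  also have "\<dots> = (\<Sum>h\<in>F. (f * x * h) * (h * y * g))"
    by (simp only: sum_distrib_left sum_distrib_right) (auto intro!: sum.cong simp: mult.assoc[symmetric] idem mult.assoc[of _ h h for h])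
  also have "\<dots> = (\<Sum>h\<in>F. if r h = r f then scaleC (coefficient f h x * coefficient h g y) (e f g) else 0)"
    using fg xy by (intro sum.cong refl) (auto simp: corner_eq e_mult_e_if mult.commute)
  also have "\<dots> = scaleC (\<Sum>h\<in>{h\<in>F. r h = r f}. coefficient f h x * coefficient h g y) (e f g)"
    by (subst complex_space.scale_sum_left) (simp add: sum.inter_filter)
  finally show "f * (x * y) * g =
    scaleC (\<Sum>h\<in>{h\<in>F. r h = r f}. coefficient f h x * coefficient h g y) (e f g)" .
qed

lemma coefficient_combination:
  assumes fg: "f \<in> F" "g \<in> F" "r f = r g"
  shows "coefficient f g (\<Sum>h\<in>F. \<Sum>k\<in>F. scaleC (m h k) (e h k)) = m f g"
proof (rule coefficient_eqI[OF fg])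
  show "(\<Sum>h\<in>F. \<Sum>k\<in>F. scaleC (m h k) (e h k)) \<in> S" by (intro subalg_closed[OF S] e_in)
  have "f * (\<Sum>h\<in>F. \<Sum>k\<in>F. scaleC (m h k) (e h k)) * g = (\<Sum>h\<in>F. \<Sum>k\<in>F. scaleC (m h k) (f * e h k * g))"
    by (simp add: sum_distrib_left sum_distrib_right)
  also have "\<dots> = (\<Sum>h\<in>F. \<Sum>k\<in>F. if k = g then if h = f then scaleC (m f g) (e f g) else 0 else 0)"
  proof (intro sum.cong refl)
    fix h k assume hk: "h \<in> F" "k \<in> F"
    have "f * e h k = 0" if "h \<noteq> f"
      by (rule mult_eq_0_via[OF idem e_left orthogonal]) (use fg hk that in auto)
    moreover have "e h k * g = 0" if "k \<noteq> g"
      by (rule mult_eq_0_via[OF e_right idem orthogonal]) (use fg hk that in auto)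
    ultimately show "scaleC (m h k) (f * e h k * g) =
      (if k = g then if h = f then scaleC (m f g) (e f g) else 0 else 0)"
      using fg hk by (auto simp: mult.assoc)
  qed
  also have "\<dots> = scaleC (m f g) (e f g)" using fg by simp
  finally show "f * (\<Sum>h\<in>F. \<Sum>k\<in>F. scaleC (m h k) (e h k)) * g = scaleC (m f g) (e f g)" .
qed

end

text \<open>All minimal projections of \<open>F\<close> stay minimal in the ambient algebra, whence \<open>F\<close> also carries a
  system \<open>(R, V)\<close> of matrix units of that algebra.  With respect to it, \<open>B\<close> consists of all matrices
  that vanish at the positions \<open>(f, g)\<close> with \<open>f\<close> and \<open>g\<close> inequivalent in \<open>B\<close>.\<close>

locale nested_matrix_units = ambient_minimal_units B F r v + ambient: matrix_units UNIV F R V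
  for B F :: "'a::cstar_algebra set" and r v R V +
  fixes bl al :: "'a list" and bs :: "'a \<Rightarrow> 'a list"
  assumes bl: "distinct bl" "set bl = r ` F"
    and al: "distinct al" "set al = R ` F"
    and bs: "p \<in> r ` F \<Longrightarrow> distinct (bs p)" "p \<in> r ` F \<Longrightarrow> set (bs p) = {f \<in> F. r f = p}"
begin

text \<open>Each class of \<open>B\<close> lies in one class of the ambient algebra; an entry 1
  records this containment.\<close>

definition \<Lambda> :: "nat mat" where
  "\<Lambda> = mat (length al) (length bl) (\<lambda>(i, j). if R (bl ! j) = al ! i then 1 else 0)"

definition ds :: "nat list" where
  "ds = map (\<lambda>p. length (bs p)) bl"

definition pos :: "nat \<Rightarrow> (nat \<times> nat) list" where
  "pos i = positions ((!) ds) (row_blocks \<Lambda> i)"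

definition ns :: "nat list" where
  "ns = map (\<lambda>i. length (pos i)) [0..<length al]"

text \<open>The members of the ambient class \<open>i\<close>, grouped by classes of
  \<open>B\<close>. This order makes \<open>B\<close> block diagonal.\<close>

definition fs :: "nat \<Rightarrow> 'a list" where
  "fs i = map (\<lambda>(j, a). bs (bl ! j) ! a) (pos i)"

text \<open>The matrix unit \<open>e f g\<close> of \<open>B\<close> is a nonzero element of the
  ambient algebra between \<open>f\<close> and \<open>g\<close>.\<close>

lemma R_eq: "f \<in> F \<Longrightarrow> g \<in> F \<Longrightarrow> r f = r g \<Longrightarrow> R f = R g"
proof (rule ccontr)
  assume fg: "f \<in> F" "g \<in> F" "r f = r g" "R f \<noteq> R g"
  have "f * e f g * g = 0" using ambient.inequivalent[OF fg(1,2,4)] by simp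
  then show False using e_nonzero[OF fg(1-3)] fg by simp
qed

lemma bl_mem: "j < length bl \<Longrightarrow> bl ! j \<in> F" "j < length bl \<Longrightarrow> r (bl ! j) = bl ! j"
  "j < length bl \<Longrightarrow> bl ! j \<in> r ` F"
  using nth_mem[of j bl] bl(2) by auto

lemma set_pos: "i < length al \<Longrightarrow> set (pos i) =
  {(j, a). j < length bl \<and> R (bl ! j) = al ! i \<and> a < length (bs (bl ! j))}"
  by (auto simp: pos_def set_positions row_blocks_def \<Lambda>_def ds_def split: if_splits)

lemma distinct_pos: "distinct (pos i)"
  unfolding pos_def row_blocks_def by (intro distinct_positions) simp

lemma bs_nth:
  assumes "j < length bl" "a < length (bs (bl ! j))"
  shows "bs (bl ! j) ! a \<in> F" "r (bs (bl ! j) ! a) = bl ! j"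
  using nth_mem[OF assms(2)] bs(2)[OF bl_mem(3)[OF assms(1)]] by auto

lemma set_fs: "i < length al \<Longrightarrow> set (fs i) = {f \<in> F. R f = al ! i}"
proof (intro equalityI subsetI)
  fix f assume i: "i < length al" and "f \<in> set (fs i)"
  then obtain j a where ja: "j < length bl" "R (bl ! j) = al ! i" "a < length (bs (bl ! j))"
    "f = bs (bl ! j) ! a" unfolding fs_def using set_pos by auto
  then have "f \<in> F" "r f = bl ! j" using bs_nth by auto
  moreover from this have "R f = R (bl ! j)" using ja bl_mem by (intro R_eq) auto
  ultimately show "f \<in> {f \<in> F. R f = al ! i}" using ja by simp
next
  fix f assume i: "i < length al" and "f \<in> {f \<in> F. R f = al ! i}"
  then have f: "f \<in> F" "R f = al ! i" by auto
  then obtain j where j: "j < length bl" "bl ! j = r f" using bl(2) by (metis imageI in_set_conv_nth)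
  then have "f \<in> set (bs (bl ! j))" using bs(2)[OF bl_mem(3)[OF j(1)]] f by simp
  then obtain a where "a < length (bs (bl ! j))" "bs (bl ! j) ! a = f" by (metis in_set_conv_nth)
  moreover have "R (bl ! j) = al ! i" using R_eq[of "bl ! j" f] bl_mem[OF j(1)] f j by simp
  ultimately have "(j, a) \<in> set (pos i)" "f = (\<lambda>(j, a). bs (bl ! j) ! a) (j, a)"
    using set_pos[OF i] j by auto
  then show "f \<in> set (fs i)" unfolding fs_def by (metis image_eqI list.set_map)
qed

lemma distinct_fs: "i < length al \<Longrightarrow> distinct (fs i)"
proof -
  assume i: "i < length al"
  have "inj_on (\<lambda>(j, a). bs (bl ! j) ! a) (set (pos i))"
  proof (rule inj_onI, clarify)
    fix j a j' a' assume ja: "(j, a) \<in> set (pos i)" "(j', a') \<in> set (pos i)"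
      and eq: "bs (bl ! j) ! a = bs (bl ! j') ! a'"
    have *: "j < length bl" "a < length (bs (bl ! j))" "j' < length bl" "a' < length (bs (bl ! j'))"
      using ja set_pos[OF i] by auto
    have "bl ! j = bl ! j'" using bs_nth(2)[OF *(1,2)] bs_nth(2)[OF *(3,4)] eq by simp
    then have "j = j'" using bl(1) * by (simp add: nth_eq_iff_index_eq)
    moreover from this have "a = a'" using eq * bs(1)[OF bl_mem(3)[OF *(1)]]
      by (simp add: nth_eq_iff_index_eq)
    ultimately show "j = j' \<and> a = a'" by simp
  qed
  then show ?thesis unfolding fs_def using distinct_pos by (simp add: distinct_map)
qed

lemma ns_nth: "i < length al \<Longrightarrow> ns ! i = length (fs i)" and length_ns: "length ns = length al"
  by (simp_all add: ns_def fs_def)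

lemma fs_nth:
  assumes "i < length al" "s < ns ! i"
  shows "fs i ! s \<in> F" "R (fs i ! s) = al ! i" "r (fs i ! s) = bl ! fst (pos i ! s)"
    "fst (pos i ! s) < length bl"
proof -
  show "fs i ! s \<in> F" "R (fs i ! s) = al ! i"
    using nth_mem[of s "fs i"] assms set_fs ns_nth by auto
  have "s < length (pos i)" using assms by (simp add: ns_nth fs_def)
  then have m: "pos i ! s \<in> set (pos i)" "fs i ! s = (\<lambda>(j, a). bs (bl ! j) ! a) (pos i ! s)"
    by (auto simp: fs_def)
  then show "r (fs i ! s) = bl ! fst (pos i ! s)" "fst (pos i ! s) < length bl"
    using set_pos[OF assms(1)] bs_nth by (auto split: prod.splits)
qed

lemma r_fs_eq_iff:
  assumes "i < length al" "s < ns ! i" "t < ns ! i"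
  shows "r (fs i ! s) = r (fs i ! t) \<longleftrightarrow> fst (pos i ! s) = fst (pos i ! t)"
  using fs_nth[OF assms(1,2)] fs_nth[OF assms(1,3)] bl(1) by (simp add: nth_eq_iff_index_eq)

lemma F_nonempty: "F \<noteq> {}"
  using sum_F by force

lemma dim_tuple_ds: "dim_tuple ds"
proof -
  have "bl \<noteq> []" using F_nonempty bl(2) by auto
  moreover have "length (bs p) \<ge> 1" if "p \<in> set bl" for p
  proof -
    have p: "p \<in> r ` F" using that bl by simp
    then have "set (bs p) \<noteq> {}" using bs(2)[OF p] by auto
    then show ?thesis by (simp add: Suc_le_eq)
  qed
  ultimately show ?thesis by (auto simp: dim_tuple_def ds_def)
qed

lemma dim_tuple_ns: "dim_tuple ns"
proof -
  have "al \<noteq> []" using F_nonempty al(2) by auto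
  then have "ns \<noteq> []" by (simp add: ns_def)
  moreover have "ns ! i \<ge> 1" if "i < length al" for i
  proof -
    have "al ! i \<in> R ` F" using al(2) nth_mem[OF that] by simp
    then have "set (fs i) \<noteq> {}" using set_fs[OF that] by auto
    then show ?thesis using that by (simp add: ns_nth Suc_le_eq)
  qed
  ultimately show ?thesis unfolding dim_tuple_def by (metis in_set_conv_nth length_ns)
qed

lemma multiplicity_free_\<Lambda>: "multiplicity_free_matrix \<Lambda>"
  unfolding multiplicity_free_matrix_def
proof (intro allI impI)
  fix j assume j: "j < dim_col \<Lambda>"
  have "(\<Sum>i<dim_row \<Lambda>. \<Lambda> $$ (i, j)) = (\<Sum>i<length al. if R (bl ! j) = al ! i then 1 else 0)"
    using j by (simp add: \<Lambda>_def)
  also have "\<dots> = card {i. i < length al \<and> R (bl ! j) = al ! i}"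
    by (simp add: sum.If_cases Int_def)
  also have "\<dots> \<le> 1"
    using al(1) by (subst card_le_Suc0_iff_eq[unfolded One_nat_def[symmetric]])
      (auto simp: nth_eq_iff_index_eq)
  finally show "(\<Sum>i<dim_row \<Lambda>. \<Lambda> $$ (i, j)) \<le> 1" .
qed

lemma inclusion_matrix_\<Lambda>: "inclusion_matrix ns ds \<Lambda>"
  unfolding inclusion_matrix_def
proof (intro conjI allI impI)
  show "\<Lambda> \<in> carrier_mat (length ns) (length ds)" by (simp add: \<Lambda>_def length_ns ds_def)
next
  fix i assume "i < length ns"
  then have i: "i < length al" by (simp add: length_ns)
  have "al ! i \<in> R ` F" using al(2) nth_mem[OF i] by simp
  then obtain f where f: "f \<in> F" "R f = al ! i" by auto
  then obtain j where j: "j < length bl" "bl ! j = r f" using bl(2) by (metis imageI in_set_conv_nth)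
  then have "R (bl ! j) = al ! i" using R_eq[of "bl ! j" f] bl_mem[OF j(1)] f by simp
  then have "row \<Lambda> i $ j \<noteq> 0\<^sub>v (length ds) $ j" using i j by (simp add: \<Lambda>_def ds_def)
  then show "row \<Lambda> i \<noteq> 0\<^sub>v (length ds)" by metis
next
  fix j assume "j < length ds"
  then have j: "j < length bl" by (simp add: ds_def)
  have "R (bl ! j) \<in> set al" using al(2) bl_mem[OF j] by simp
  then obtain i where i: "i < length al" "al ! i = R (bl ! j)" by (metis in_set_conv_nth)
  then have "col \<Lambda> j $ i \<noteq> 0\<^sub>v (length ns) $ i" using i j by (simp add: \<Lambda>_def length_ns)
  then show "col \<Lambda> j \<noteq> 0\<^sub>v (length ns)" by metis
next
  show "\<Lambda> *\<^sub>v vec_of_list ds = vec_of_list ns"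
  proof (rule eq_vecI)
    fix i assume "i < dim_vec (vec_of_list ns)"
    then have i: "i < length al" by (simp add: length_ns)
    have "ns ! i = (\<Sum>j<dim_col \<Lambda>. \<Lambda> $$ (i, j) * ds ! j)"
      using i by (simp add: ns_def pos_def) (subst length_row_positions, auto simp: \<Lambda>_def)
    then show "(\<Lambda> *\<^sub>v vec_of_list ds) $ i = vec_of_list ns $ i"
      using i by (simp add: vec_of_list_index scalar_prod_def \<Lambda>_def ds_def atLeast0LessThan)
  qed (simp add: \<Lambda>_def length_ns)
qed

definition \<theta> :: "'a \<Rightarrow> complex mat list" where
  "\<theta> x = map (\<lambda>i. mat (ns ! i) (ns ! i) (\<lambda>(s, t). ambient.coefficient (fs i ! s) (fs i ! t) x))
    [0..<length al]"

lemma length_\<theta>: "length (\<theta> x) = length al"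
  and \<theta>_carrier: "i < length al \<Longrightarrow> \<theta> x ! i \<in> carrier_mat (ns ! i) (ns ! i)"
  and \<theta>_index: "i < length al \<Longrightarrow> s < ns ! i \<Longrightarrow> t < ns ! i \<Longrightarrow>
    \<theta> x ! i $$ (s, t) = ambient.coefficient (fs i ! s) (fs i ! t) x"
  by (simp_all add: \<theta>_def)

lemma \<theta>_dim: "i < length al \<Longrightarrow> dim_row (\<theta> x ! i) = ns ! i" "i < length al \<Longrightarrow> dim_col (\<theta> x ! i) = ns ! i"
  using \<theta>_carrier by auto

lemma \<theta>_in: "\<theta> x \<in> matrix_sum ns"
  by (simp add: matrix_sum_def length_\<theta> length_ns \<theta>_carrier)

lemma class_index:
  assumes "f \<in> F" "g \<in> F" "R f = R g"
  obtains i s t where "i < length al" "s < ns ! i" "t < ns ! i" "f = fs i ! s" "g = fs i ! t"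
proof -
  obtain i where i: "i < length al" "al ! i = R f" using al(2) assms(1) by (metis imageI in_set_conv_nth)
  then have "f \<in> set (fs i)" "g \<in> set (fs i)" using set_fs[OF i(1)] assms by auto
  then show thesis using that[OF i(1)] by (metis i(1) in_set_conv_nth ns_nth)
qed

lemma \<theta>_eqI:
  assumes "length Ms = length al" "\<And>i. i < length al \<Longrightarrow> Ms ! i \<in> carrier_mat (ns ! i) (ns ! i)"
    "\<And>i s t. i < length al \<Longrightarrow> s < ns ! i \<Longrightarrow> t < ns ! i \<Longrightarrow>
      ambient.coefficient (fs i ! s) (fs i ! t) x = Ms ! i $$ (s, t)"
  shows "\<theta> x = Ms"
proof (rule nth_equalityI)
  fix i assume "i < length (\<theta> x)"
  then have i: "i < length al" by (simp add: length_\<theta>)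
  show "\<theta> x ! i = Ms ! i"
    by (rule eq_matI) (use assms(2)[OF i] assms(3)[OF i] \<theta>_carrier[OF i] i in \<open>auto simp: \<theta>_index\<close>)
qed (simp add: assms length_\<theta>)

lemma star_isomorphism_\<theta>: "star_isomorphism ns \<theta>"
  unfolding star_isomorphism_def
proof (intro conjI allI)
  show "bij_betw \<theta> UNIV (matrix_sum ns)"
    unfolding bij_betw_def
  proof
    show "inj \<theta>"
    proof (rule injI)
      fix x y assume eq: "\<theta> x = \<theta> y"
      have "scaleC (ambient.coefficient f g x) (ambient.e f g) = scaleC (ambient.coefficient f g y) (ambient.e f g)"
        if fg: "f \<in> F" "g \<in> F" for f g
      proof (cases "R f = R g")
        case True
        obtain i s t where "i < length al" "s < ns ! i" "t < ns ! i" "f = fs i ! s" "g = fs i ! t"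
          using class_index[OF fg True] .
        then show ?thesis using \<theta>_index[of i s t x] \<theta>_index[of i s t y] eq by simp
      qed (simp add: fg ambient.e_eq_0)
      then show "x = y" using ambient.expand[of x] ambient.expand[of y]
        by (metis (no_types, lifting) UNIV_I sum.cong)
    qed
    show "range \<theta> = matrix_sum ns"
    proof (intro equalityI subsetI)
      fix Ms assume "Ms \<in> matrix_sum ns"
      then have Ms: "length Ms = length al" "\<And>i. i < length al \<Longrightarrow> Ms ! i \<in> carrier_mat (ns ! i) (ns ! i)"
        by (auto simp: matrix_sum_def length_ns)
      \<comment> \<open>Inverses of the enumerations of the ambient classes and of their members, by
        which the coefficients of a preimage are prescribed.\<close>
      define ai where "ai f = (THE i. i < length al \<and> al ! i = R f)" for f
      define ix where "ix i f = (THE s. s < length (fs i) \<and> fs i ! s = f)" for i f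
      have ai: "ai (fs i ! s) = i" if "i < length al" "s < ns ! i" for i s
        unfolding ai_def using that fs_nth(2)[OF that] al(1)
        by (intro the_equality) (auto simp: nth_eq_iff_index_eq)
      have ix: "ix i (fs i ! s) = s" if "i < length al" "s < ns ! i" for i s
        unfolding ix_def using that distinct_fs[OF that(1)] ns_nth[OF that(1)]
        by (intro the_equality) (auto simp: nth_eq_iff_index_eq)
      define m where "m f g = Ms ! ai f $$ (ix (ai f) f, ix (ai f) g)" for f g
      have "\<theta> (\<Sum>h\<in>F. \<Sum>k\<in>F. scaleC (m h k) (ambient.e h k)) = Ms"
      proof (rule \<theta>_eqI[OF Ms])
        fix i s t assume i: "i < length al" and st: "s < ns ! i" "t < ns ! i"
        show "ambient.coefficient (fs i ! s) (fs i ! t) (\<Sum>h\<in>F. \<Sum>k\<in>F. scaleC (m h k) (ambient.e h k)) =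
          Ms ! i $$ (s, t)"
          using ambient.coefficient_combination[of "fs i ! s" "fs i ! t" m]
            fs_nth[OF i st(1)] fs_nth[OF i st(2)] ai[OF i st(1)] ix[OF i st(1)] ix[OF i st(2)]
          by (simp add: m_def)
      qed
      then show "Ms \<in> range \<theta>" by blast
    qed (use \<theta>_in in auto)
  qed
next
  fix x y
  show "\<theta> (x + y) = map2 (+) (\<theta> x) (\<theta> y)"
    by (rule \<theta>_eqI) (use \<theta>_carrier[of _ y] in
      \<open>auto simp: length_\<theta> \<theta>_carrier \<theta>_dim \<theta>_index ambient.coefficient_add fs_nth\<close>)
  show "\<theta> (x * y) = map2 (*) (\<theta> x) (\<theta> y)"
  proof (rule \<theta>_eqI)
    fix i s t assume i: "i < length al" and st: "s < ns ! i" "t < ns ! i"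
    have "ambient.coefficient (fs i ! s) (fs i ! t) (x * y) =
      (\<Sum>h\<in>set (fs i). ambient.coefficient (fs i ! s) h x * ambient.coefficient h (fs i ! t) y)"
      using fs_nth[OF i st(1)] fs_nth[OF i st(2)] set_fs[OF i] by (simp add: ambient.coefficient_mult)
    also have "\<dots> = (\<Sum>k<ns ! i. ambient.coefficient (fs i ! s) (fs i ! k) x *
       ambient.coefficient (fs i ! k) (fs i ! t) y)"
      unfolding ns_nth[OF i]
      by (rule sum.reindex_bij_betw[OF bij_betw_nth[OF distinct_fs[OF i] refl refl], symmetric])
    also have "\<dots> = (\<theta> x ! i * \<theta> y ! i) $$ (s, t)"
      using i st by (simp add: mult_mat_index[OF \<theta>_carrier[OF i] \<theta>_carrier[OF i] st] \<theta>_index)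
    finally show "ambient.coefficient (fs i ! s) (fs i ! t) (x * y) = map2 (*) (\<theta> x) (\<theta> y) ! i $$ (s, t)"
      using i by (simp add: length_\<theta>)
  qed (use \<theta>_carrier[of _ x] \<theta>_carrier[of _ y] in \<open>auto simp: length_\<theta> intro!: mult_carrier_mat\<close>)
next
  fix c x
  show "\<theta> (scaleC c x) = map (\<lambda>M. c \<cdot>\<^sub>m M) (\<theta> x)"
    by (rule \<theta>_eqI) (use \<theta>_carrier[of _ x] in
      \<open>auto simp: length_\<theta> \<theta>_carrier \<theta>_dim \<theta>_index ambient.coefficient_scaleC fs_nth\<close>)
next
  fix x
  show "\<theta> (star x) = map mat_adjoint (\<theta> x)"
  proof (rule \<theta>_eqI)
    fix i s t assume i: "i < length al" and st: "s < ns ! i" "t < ns ! i"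
    show "ambient.coefficient (fs i ! s) (fs i ! t) (star x) = map mat_adjoint (\<theta> x) ! i $$ (s, t)"
      using i st fs_nth[OF i st(1)] fs_nth[OF i st(2)]
        ambient.coefficient_star[of "fs i ! t" x "fs i ! s"]
      by (simp add: length_\<theta> mat_adjoint_index[OF \<theta>_carrier[OF i] st] \<theta>_index)
  qed (simp_all add: length_\<theta> \<theta>_carrier)
qed

text \<open>Membership in \<open>B\<close> is tested on corners: those inside a class of
  \<open>B\<close> always belong to it, those between different classes must vanish.\<close>

lemma \<theta>_image: "\<theta> ` B = Phi \<Lambda> ` matrix_sum ds"
proof -
  \<comment> \<open>Inside an ambient class the matrix unit is nonzero, so a corner and its entry
    vanish together.\<close>
  have eq0: "fs i ! s * x * fs i ! t = 0 \<longleftrightarrow> \<theta> x ! i $$ (s, t) = 0"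
    if i: "i < length al" and st: "s < ns ! i" "t < ns ! i" for x i s t
    using ambient.corner_eq[of "fs i ! s" "fs i ! t" x] ambient.e_nonzero[of "fs i ! s" "fs i ! t"]
      fs_nth[OF i st(1)] fs_nth[OF i st(2)] by (simp add: \<theta>_index i st)
  have "x \<in> B \<longleftrightarrow> (\<forall>i<length al. \<forall>s<ns ! i. \<forall>t<ns ! i.
    fst (pos i ! s) \<noteq> fst (pos i ! t) \<longrightarrow> \<theta> x ! i $$ (s, t) = 0)" (is "_ = ?R") for x
  proof
    assume "x \<in> B"
    then show ?R using inequivalent fs_nth r_fs_eq_iff eq0 by metis
  next
    assume R: ?R
    have "f * x * g \<in> B" if fg: "f \<in> F" "g \<in> F" for f g
    proof (cases "r f = r g")
      case True
      then show ?thesis using class_corner_in fg by blast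
    next
      case ne: False
      have "f * x * g = 0"
      proof (cases "R f = R g")
        case True
        obtain i s t where *: "i < length al" "s < ns ! i" "t < ns ! i" "f = fs i ! s" "g = fs i ! t"
          using class_index[OF fg True] .
        then show ?thesis using R ne r_fs_eq_iff[OF *(1-3)] eq0[OF *(1-3), of x] by simp
      next
        case False
        then show ?thesis using ambient.inequivalent fg by blast
      qed
      then show ?thesis using subalg_zero[OF S] by simp
    qed
    then show "x \<in> B" by (subst decompose) (intro subalg_sum[OF S])
  qed
  then have "\<theta> ` B = {Ms \<in> range \<theta>. \<forall>i<length al. \<forall>s<ns ! i. \<forall>t<ns ! i.
    fst (pos i ! s) \<noteq> fst (pos i ! t) \<longrightarrow> Ms ! i $$ (s, t) = 0}"
    by blast
  moreover have "range \<theta> = matrix_sum ns"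
    using star_isomorphism_\<theta> by (auto simp: star_isomorphism_def bij_betw_def)
  ultimately show ?thesis
    unfolding Phi_image[OF inclusion_matrix_\<Lambda> multiplicity_free_\<Lambda>]
      block_positions_def[OF inclusion_matrix_\<Lambda> multiplicity_free_\<Lambda>] length_ns pos_def[symmetric]
    by simp
qed

text \<open>The ordering of \<open>fs\<close> already puts \<open>B\<close> into block form, so
  identity matrices serve as the unitary.\<close>

lemma multiplicity_free: "multiplicity_free B"
proof -
  define us where "us = map (\<lambda>n. 1\<^sub>m n :: complex mat) ns"
  have adj: "mat_adjoint (1\<^sub>m n) = (1\<^sub>m n :: complex mat)" for n
    by (rule eq_matI) (use mat_adjoint_carrier[OF one_carrier_mat, of n] in
      \<open>auto simp: mat_adjoint_index[OF one_carrier_mat] simp del: mat_adjoint_carrier\<close>)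
  have "unitary_in ns us"
    by (auto simp: unitary_in_def us_def matrix_sum_def adj)
  moreover have "map2 (\<lambda>u x. u * x * mat_adjoint u) us (\<theta> b) = \<theta> b" for b
    by (rule nth_equalityI) (auto simp: us_def length_\<theta> length_ns adj
        left_mult_one_mat[OF \<theta>_carrier] right_mult_one_mat[OF \<theta>_carrier])
  then have "(\<lambda>b. map2 (\<lambda>u x. u * x * mat_adjoint u) us (\<theta> b)) ` B = Phi \<Lambda> ` matrix_sum ds"
    using \<theta>_image by simp
  ultimately show ?thesis
    unfolding multiplicity_free_def
    using S dim_tuple_ns dim_tuple_ds star_isomorphism_\<theta> inclusion_matrix_\<Lambda> multiplicity_free_\<Lambda>
    by blast
qed

end

lemma (in ambient_minimal_units) multiplicity_free: "multiplicity_free B"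
proof -
  have "orthogonal_decomposition UNIV F 1"
    using F ambient_min by (auto simp: orthogonal_decomposition_def)
  then obtain R V where RV: "matrix_units UNIV F R V"
    using matrix_units_exist[OF unital_UNIV] by blast
  obtain bl where bl: "distinct bl" "set bl = r ` F"
    using finite_distinct_list[of "r ` F"] by auto
  obtain al where al: "distinct al" "set al = R ` F"
    using finite_distinct_list[of "R ` F"] by auto
  have "\<exists>xs. distinct xs \<and> set xs = {f \<in> F. r f = p}" for p
    using finite_distinct_list[of "{f \<in> F. r f = p}"] by auto
  then obtain bs where "\<And>p. distinct (bs p)" "\<And>p. set (bs p) = {f \<in> F. r f = p}" by metis
  then have "nested_matrix_units B F r v R V bl al bs"
    unfolding nested_matrix_units_def nested_matrix_units_axioms_def
    using RV bl al ambient_minimal_units_axioms by simp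
  then show ?thesis by (rule nested_matrix_units.multiplicity_free)
qed

theorem theorem5p7:
  fixes B :: "'a::cstar_algebra set"
  assumes "finite_dimensional TYPE('a)"
    and "unital_cstar_subalgebra B"
  shows "(generalised_cartan B \<longleftrightarrow> regular B \<and> Max' B) \<and>
         (regular B \<and> Max' B \<longleftrightarrow> Max' B) \<and>
         (Max' B \<longleftrightarrow> relative_commutant B \<subseteq> B) \<and>
         (relative_commutant B \<subseteq> B \<longleftrightarrow> relative_commutant B = center B) \<and>
         (relative_commutant B = center B \<longleftrightarrow> multiplicity_free B) \<and>
         (multiplicity_free B \<longleftrightarrow> (\<exists>!E. conditional_expectation B E))"
proof -
  note fd = assms(1) and B = assms(2)
  have "projection (1::'a)" by (simp add: projection_def)
  then obtain F where F: "orthogonal_decomposition B F 1"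
    using orthogonal_decomposition_exists[OF fd B subalg_one[OF B]] by blast
  obtain r v where "matrix_units B F r v" using matrix_units_exist[OF B F] by blast
  then interpret matrix_units B F r v .
  have unique: "relative_commutant B \<subseteq> B" if "\<exists>!E. conditional_expectation B E"
    using commutant_subset_of_minimal minimal_of_unique_expectation[OF fd that] by blast
  have center: "relative_commutant B \<subseteq> B \<longleftrightarrow> relative_commutant B = center B"
    by (auto simp: center_def relative_commutant_def)
  \<comment> \<open>All conditions follow from containment of the commutant; the converse
    implications return to it, through \<open>Max'\<close> in the case of the first two
    conditions.\<close>
  have main: "generalised_cartan B \<and> regular B \<and> Max' B \<and> multiplicity_free B \<and>
    (\<exists>!E. conditional_expectation B E)" if comm: "relative_commutant B \<subseteq> B"
  proof -
    interpret ambient_minimal_units B F r v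
      by unfold_locales (rule minimal_in_ambient[OF comm])
    obtain E where E: "conditional_expectation B E" using expectation_exists by blast
    have "generalised_cartan B"
      using B E expectation_faithful[OF E] regular Max'_of_commutant_subset[OF comm]
        contains_approximate_unit_unital[OF B]
      by (auto simp: generalised_cartan_def unital_cstar_subalgebra_def)
    then show ?thesis
      using E expectation_unique regular Max'_of_commutant_subset[OF comm] multiplicity_free by blast
  qed
  have "generalised_cartan B \<Longrightarrow> Max' B" by (simp add: generalised_cartan_def)
  then show ?thesis
    using main unique center commutant_subset_of_Max'[OF B] commutant_subset_of_multiplicity_free
    by blast
qed

end
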